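(* Let $p=[p_1\exp_{\lambda^1},\dots,p_m\exp_{\lambda^m}]^T$ with $p_i\in A=\mathbb C[t_1,\dots,t_n]$ and $\lambda^i\in\mathbb C^n$. Partition $\{1,\dots,m\}=K_1\,\dot\cup\cdots\dot\cup\,K_l$ into the classes of indices with equal exponent vector, $K_i=\{k_{i1}<\dots<k_{il_i}\}$ with common exponent $\mu^i:=\lambda^{k_{i1}}$. Put $h_i=[p_{k_{i1}},\dots,p_{k_{il_i}}]^T\in A^{l_i}$, $H_i=\sigma_{\mu^i}(\ker(\kappa_{h_i}))\subseteq\mathcal W_n^{1\times l_i}$ ($\sigma_{\mu^i}$ applied entrywise), and $\phi_i:\mathcal W_n^{1\times l_i}\to\mathcal W_n^{1\times m}$, $[a_1,\dots,a_{l_i}]\mapsto\sum_{j=1}^{l_i}a_je_{k_{ij}}$. Then $$\{a\in\mathcal W_n^{1\times m}:\textstyle\sum_{j=1}^m a_j\bullet(p_j\exp_{\lambda^j})=0\}=\bigoplus_{i=1}^l\phi_i(H_i),$$ and consequently a matrix whose rows generate $\bigoplus_i\phi_i(H_i)$ is a kernel representation of the VMPUM of $\{p\}$.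
   Context: $\mathcal W_n$ is the $n$-th Weyl algebra $\mathbb C[t_1,\dots,t_n]\langle\partial_1,\dots,\partial_n\rangle$ with $\partial_it_j=t_j\partial_i+\delta_{ij}$, acting on $C^\infty(\mathbb R^n,\mathbb C)$ by $\partial_i\bullet f=\partial f/\partial t_i$ and multiplication by $t_i$. For $\lambda\in\mathbb C^n$, $\exp_\lambda=\exp(\lambda_1t_1+\dots+\lambda_nt_n)$. For $q\in A^k$, $\ker(\kappa_q)=\{a\in\mathcal W_n^{1\times k}:\sum_ia_i\bullet q_i=0\}$. For $\lambda\in\mathbb C^n$, $\sigma_\lambda$ is the $\mathbb C$-algebra automorphism of $\mathcal W_n$ with $t_i\mapsto t_i$, $\partial_i\mapsto\partial_i-\lambda_i$. $e_k$ are the canonical basis vectors of $\mathcal W_n^{1\times m}$. The VMPUM of a set $\Omega$ of signals is the smallest solution set $\{g:R\bullet g=0\}$ ($R$ a matrix over $\mathcal W_n$) containing $\Omega$. *)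

theory Defs
  imports "HOL-Analysis.Analysis"
begin

text \<open>Variables t_1..t_n are indexed by a finite type 'n (so n = CARD('n)).
  Signals are functions real^'n => complex.
  Elements of the Weyl algebra W_n are given in normal-ordered form
  sum c_(alpha,beta) t^alpha d^beta, i.e. as finitely supported coefficient
  functions on pairs of multi-indices. Polynomials in A = C[t] are finitely
  supported coefficient functions on multi-indices.\<close>

type_synonym 'n weyl = "('n \<Rightarrow> nat) \<times> ('n \<Rightarrow> nat) \<Rightarrow> complex"
type_synonym 'n cpoly = "('n \<Rightarrow> nat) \<Rightarrow> complex"
type_synonym 'n signal = "real^'n \<Rightarrow> complex"

definition is_weyl :: "'n weyl \<Rightarrow> bool" where
  "is_weyl w \<longleftrightarrow> finite {c. w c \<noteq> 0}"

definition is_cpoly :: "'n cpoly \<Rightarrow> bool" where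
  "is_cpoly p \<longleftrightarrow> finite {\<alpha>. p \<alpha> \<noteq> 0}"

definition monval :: "('n::finite \<Rightarrow> nat) \<Rightarrow> 'n signal" where
  "monval \<alpha> x = (\<Prod>i\<in>UNIV. complex_of_real (x$i) ^ \<alpha> i)"

definition poly_fun :: "'n::finite cpoly \<Rightarrow> 'n signal" where
  "poly_fun p x = (\<Sum>\<alpha>\<in>{\<alpha>. p \<alpha> \<noteq> 0}. p \<alpha> * monval \<alpha> x)"

definition exp_fun :: "('n::finite \<Rightarrow> complex) \<Rightarrow> 'n signal" where
  "exp_fun lam x = exp (\<Sum>i\<in>UNIV. lam i * complex_of_real (x$i))"

definition partial :: "'n::finite \<Rightarrow> 'n signal \<Rightarrow> 'n signal" where
  "partial i f x = vector_derivative (\<lambda>s::real. f (x + s *\<^sub>R axis i 1)) (at 0)"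

definition iter_partial :: "'n::finite list \<Rightarrow> 'n signal \<Rightarrow> 'n signal" where
  "iter_partial is f = foldr partial is f"

definition smooth :: "'n::finite signal \<Rightarrow> bool" where
  "smooth f \<longleftrightarrow> (\<forall>is. continuous_on UNIV (iter_partial is f) \<and>
     (\<forall>i x. (\<lambda>s::real. iter_partial is f (x + s *\<^sub>R axis i 1)) differentiable (at 0)))"

definition var_list :: "'n::finite list" where
  "var_list = (SOME xs. distinct xs \<and> set xs = UNIV)"

definition dpow :: "('n::finite \<Rightarrow> nat) \<Rightarrow> 'n signal \<Rightarrow> 'n signal" where
  "dpow \<beta> f = iter_partial (concat (map (\<lambda>i. replicate (\<beta> i) i) var_list)) f"

definition act :: "'n::finite weyl \<Rightarrow> 'n signal \<Rightarrow> 'n signal" where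
  "act w f x = (\<Sum>c\<in>{c. w c \<noteq> 0}. w c * monval (fst c) x * dpow (snd c) f x)"

text \<open>Product in W_n of normal-ordered elements:
  (t^a d^b)(t^g d^e) = sum_{k<=b,k<=g} prod_i C(b_i,k_i) g_i!/(g_i-k_i)! t^(a+g-k) d^(b-k+e)\<close>
definition weyl_mult :: "'n::finite weyl \<Rightarrow> 'n weyl \<Rightarrow> 'n weyl" where
  "weyl_mult x y = (\<lambda>(a,b). \<Sum>u\<in>{u. x u \<noteq> 0}. \<Sum>v\<in>{v. y v \<noteq> 0}.
      \<Sum>\<kappa>\<in>{\<kappa>. \<forall>i. \<kappa> i \<le> snd u i \<and> \<kappa> i \<le> fst v i}.
        if a = (\<lambda>i. fst u i + fst v i - \<kappa> i) \<and> b = (\<lambda>i. snd u i - \<kappa> i + snd v i)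
        then x u * y v * (\<Prod>i\<in>UNIV. of_nat (snd u i choose \<kappa> i) *
                 (of_nat (fact (fst v i)) / of_nat (fact (fst v i - \<kappa> i))))
        else 0)"

text \<open>The automorphism sigma_lambda (t_i -> t_i, d_i -> d_i - lambda_i), written out on
  normal forms: t^a d^b -> t^a prod_i (d_i - lambda_i)^(b_i)\<close>
definition sigma :: "('n::finite \<Rightarrow> complex) \<Rightarrow> 'n weyl \<Rightarrow> 'n weyl" where
  "sigma lam w = (\<lambda>(a,b). \<Sum>u\<in>{u. w u \<noteq> 0}.
      if fst u = a \<and> (\<forall>i. b i \<le> snd u i)
      then w u * (\<Prod>i\<in>UNIV. of_nat (snd u i choose b i) * (- lam i) ^ (snd u i - b i))
      else 0)"

definition row_space :: "nat \<Rightarrow> (nat \<Rightarrow> 'n weyl) set" where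
  "row_space m = {a. (\<forall>j<m. is_weyl (a j)) \<and> (\<forall>j\<ge>m. a j = (\<lambda>_. 0))}"

definition kerset :: "nat \<Rightarrow> (nat \<Rightarrow> 'n::finite signal) \<Rightarrow> (nat \<Rightarrow> 'n weyl) set" where
  "kerset m q = {a \<in> row_space m. (\<lambda>x. \<Sum>j<m. act (a j) (q j) x) = (\<lambda>x. 0)}"

definition sigma_row :: "('n::finite \<Rightarrow> complex) \<Rightarrow> (nat \<Rightarrow> 'n weyl) \<Rightarrow> (nat \<Rightarrow> 'n weyl)" where
  "sigma_row lam a = (\<lambda>j. sigma lam (a j))"

definition epvec :: "nat \<Rightarrow> (nat \<Rightarrow> 'n::finite cpoly) \<Rightarrow> (nat \<Rightarrow> 'n \<Rightarrow> complex) \<Rightarrow> nat \<Rightarrow> 'n signal" where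
  "epvec m p lam = (\<lambda>j. if j < m then (\<lambda>x. poly_fun (p j) x * exp_fun (lam j) x) else (\<lambda>_. 0))"

definition Kclasses :: "nat \<Rightarrow> (nat \<Rightarrow> 'n \<Rightarrow> complex) \<Rightarrow> nat set set" where
  "Kclasses m lam = {{k. k < m \<and> lam k = lam j} | j. j < m}"

definition hvec :: "(nat \<Rightarrow> 'n::finite cpoly) \<Rightarrow> nat set \<Rightarrow> nat \<Rightarrow> 'n signal" where
  "hvec p K = (\<lambda>j. if j < card K then poly_fun (p (sorted_list_of_set K ! j)) else (\<lambda>_. 0))"

definition Hset :: "(nat \<Rightarrow> 'n::finite cpoly) \<Rightarrow> (nat \<Rightarrow> 'n \<Rightarrow> complex) \<Rightarrow> nat set \<Rightarrow> (nat \<Rightarrow> 'n weyl) set" where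
  "Hset p lam K = sigma_row (lam (Min K)) ` kerset (card K) (hvec p K)"

definition phi :: "nat set \<Rightarrow> (nat \<Rightarrow> 'n weyl) \<Rightarrow> (nat \<Rightarrow> 'n weyl)" where
  "phi K a = (\<lambda>k c. \<Sum>j<card K. if sorted_list_of_set K ! j = k then a j c else 0)"

definition vsum_sets :: "'i set \<Rightarrow> ('i \<Rightarrow> (nat \<Rightarrow> 'n weyl) set) \<Rightarrow> (nat \<Rightarrow> 'n weyl) set" where
  "vsum_sets I M = {(\<lambda>k c. \<Sum>i\<in>I. x i k c) | x. \<forall>i\<in>I. x i \<in> M i}"

definition is_direct :: "'i set \<Rightarrow> ('i \<Rightarrow> (nat \<Rightarrow> 'n weyl) set) \<Rightarrow> bool" where
  "is_direct I M \<longleftrightarrow> (\<forall>x. (\<forall>i\<in>I. x i \<in> M i) \<and> (\<lambda>k c. \<Sum>i\<in>I. x i k c) = (\<lambda>k c. 0)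
      \<longrightarrow> (\<forall>i\<in>I. x i = (\<lambda>k c. 0)))"

definition gen_module :: "nat \<Rightarrow> (nat \<Rightarrow> nat \<Rightarrow> 'n::finite weyl) \<Rightarrow> (nat \<Rightarrow> 'n weyl) set" where
  "gen_module k R = {(\<lambda>j c. \<Sum>r<k. weyl_mult (co r) (R r j) c) | co. \<forall>r<k. is_weyl (co r)}"

definition sigvec :: "nat \<Rightarrow> (nat \<Rightarrow> 'n::finite signal) set" where
  "sigvec m = {g. (\<forall>j<m. smooth (g j)) \<and> (\<forall>j\<ge>m. g j = (\<lambda>_. 0))}"

definition solset :: "nat \<Rightarrow> nat \<Rightarrow> (nat \<Rightarrow> nat \<Rightarrow> 'n::finite weyl) \<Rightarrow> (nat \<Rightarrow> 'n signal) set" where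
  "solset m k R = {g \<in> sigvec m. \<forall>r<k. (\<lambda>x. \<Sum>j<m. act (R r j) (g j) x) = (\<lambda>x. 0)}"

definition is_solset :: "nat \<Rightarrow> (nat \<Rightarrow> 'n::finite signal) set \<Rightarrow> bool" where
  "is_solset m S \<longleftrightarrow> (\<exists>k R. (\<forall>r<k. R r \<in> row_space m) \<and> S = solset m k R)"

definition is_VMPUM :: "nat \<Rightarrow> (nat \<Rightarrow> 'n::finite signal) set \<Rightarrow> (nat \<Rightarrow> 'n signal) set \<Rightarrow> bool" where
  "is_VMPUM m \<Omega> S \<longleftrightarrow> is_solset m S \<and> \<Omega> \<subseteq> S \<and> (\<forall>S'. is_solset m S' \<and> \<Omega> \<subseteq> S' \<longrightarrow> S \<subseteq> S')"

end

theory Submission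
  imports Defs "HOL-Computational_Algebra.Polynomial"
begin

text \<open>
  Multiplication by \<open>exp_fun \<mu>\<close> intertwines an operator \<open>w\<close> with \<open>sigma (-\<mu>) w\<close>, so the part of
  \<open>\<Sum>j. a j \<bullet> (p j * exp_fun (lam j))\<close> coming from one class of equal exponents is a polynomial times
  \<open>exp_fun \<mu>\<close>. Exponentials with distinct exponents are linearly independent over the polynomial
  functions, hence every such part vanishes separately, which is the decomposition of the kernel.
  For the VMPUM, the rows of any system satisfied by the given signal lie in that kernel, so they are
  left combinations of the rows of \<open>R\<close>; since \<open>weyl_mult\<close> is composition of operators on smooth
  signals (by the Leibniz rule and the symmetry of mixed partial derivatives), they annihilate every
  solution of \<open>R\<close>.
\<close>

subsection \<open>Smooth signals\<close>

text \<open>\<open>smooth\<close> and \<open>partial\<close> speak only of derivatives along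
  coordinate axes, and \<open>sigma\<close> and \<open>weyl_mult\<close> are bare coefficient
  formulas on normal forms. Hence symmetry of derivatives and the Leibniz rule are built up from
  axis-parallel lines, and the algebra is read off from what the formulas do to functions: the
  constants of \<open>weyl_mult\<close> are those of the Leibniz rule with a monomial factor, the
  constants of \<open>sigma\<close> those of the Leibniz rule with an exponential factor.
  Coefficients are compared only where an operator itself has to be recovered. First, the summands
  \<open>Hset\<close> are images under \<open>sigma\<close>, so a kernel row must be pulled back by
  the opposite shift and pushed forward to the very same row. Second, \<open>weyl_one\<close> must
  be a left unit, so that the rows of \<open>R\<close> belong to the module they generate.\<close>

definition has_partial :: "'n::finite \<Rightarrow> 'n signal \<Rightarrow> 'n signal \<Rightarrow> bool" where
  "has_partial i f f' \<longleftrightarrow>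
     (\<forall>x. ((\<lambda>s::real. f (x + s *\<^sub>R axis i 1)) has_vector_derivative f' x) (at 0))"

text \<open>\<open>vector_derivative\<close> has a value even where no derivative exists. The
  relation \<open>has_partial\<close> carries existence along, so the rules of calculus are proved
  for it and transferred to \<open>partial\<close> here.\<close>

lemma has_partial_imp_partial: "has_partial i f f' \<Longrightarrow> partial i f = f'"
  by (auto simp: has_partial_def partial_def fun_eq_iff intro: vector_derivative_at)

lemma has_partial_const: "has_partial i (\<lambda>x. c) (\<lambda>x. 0)"
  by (simp add: has_partial_def)

lemma has_partial_add:
  "has_partial i f f' \<Longrightarrow> has_partial i g g' \<Longrightarrow> has_partial i (\<lambda>x. f x + g x) (\<lambda>x. f' x + g' x)"
  by (auto simp: has_partial_def intro!: has_vector_derivative_add)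

lemma has_partial_mult:
  assumes "has_partial i f f'" "has_partial i g g'"
  shows "has_partial i (\<lambda>x. f x * g x) (\<lambda>x. f' x * g x + f x * g' x)"
  unfolding has_partial_def
proof
  fix x
  show "((\<lambda>s. f (x + s *\<^sub>R axis i 1) * g (x + s *\<^sub>R axis i 1)) has_vector_derivative
          f' x * g x + f x * g' x) (at 0)"
    using has_vector_derivative_mult[OF assms[unfolded has_partial_def, THEN spec, of x]]
    by (simp add: add.commute)
qed

text \<open>\<open>has_partial\<close> differentiates at parameter 0 only, but at every base point;
  moving the base point along the line yields the derivative at every parameter.\<close>

lemma has_partial_along_line:
  assumes "has_partial i f f'"
  shows "((\<lambda>s. f (x + s *\<^sub>R axis i 1)) has_vector_derivative f' (x + s *\<^sub>R axis i 1)) (at s)"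
proof -
  have 1: "((\<lambda>r. f ((x + s *\<^sub>R axis i 1) + r *\<^sub>R axis i 1)) has_vector_derivative f' (x + s *\<^sub>R axis i 1))
          (at (s - s))"
    using assms by (simp add: has_partial_def)
  have 2: "((\<lambda>r. r - s) has_real_derivative 1) (at s)"
    by (auto intro!: derivative_eq_intros)
  show ?thesis
    using vector_diff_chain_at[of "\<lambda>r. r - s" 1 s, OF _ 1] 2
    by (simp add: o_def algebra_simps has_real_derivative_iff_has_vector_derivative)
qed

lemma smooth_imp_continuous: "smooth f \<Longrightarrow> continuous_on UNIV f"
  unfolding smooth_def by (drule spec[of _ "[]"]) (simp add: iter_partial_def)

lemma smooth_has_partial: "smooth f \<Longrightarrow> has_partial i f (partial i f)"
  unfolding smooth_def has_partial_def partial_def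
  by (drule spec[of _ "[]"]) (simp add: iter_partial_def vector_derivative_works)

lemma smooth_partial: "smooth f \<Longrightarrow> smooth (partial i f)"
  unfolding smooth_def
proof
  fix js
  assume "\<forall>js. continuous_on UNIV (iter_partial js f) \<and>
    (\<forall>i x. (\<lambda>s::real. iter_partial js f (x + s *\<^sub>R axis i 1)) differentiable (at 0))"
  from spec[OF this, of "js @ [i]"]
  show "continuous_on UNIV (iter_partial js (partial i f)) \<and>
    (\<forall>k x. (\<lambda>s::real. iter_partial js (partial i f) (x + s *\<^sub>R axis k 1)) differentiable (at 0))"
    by (simp add: iter_partial_def)
qed

lemma smooth_iter_partial: "smooth f \<Longrightarrow> smooth (iter_partial js f)"
  by (induction js) (auto simp: iter_partial_def smooth_partial)

text \<open>Smoothness as a greatest fixed point: iterated partial derivatives never leave a family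
  that is closed under differentiation. Smoothness proofs reduce to finding such a family.\<close>

lemma smooth_coinduct:
  assumes "f \<in> F"
    and cont: "\<And>f. f \<in> F \<Longrightarrow> continuous_on UNIV f"
    and step: "\<And>f i. f \<in> F \<Longrightarrow> \<exists>f'\<in>F. has_partial i f f'"
  shows "smooth f"
proof -
  have "iter_partial js f \<in> F" for js
    using assms(1)
  proof (induction js)
    case (Cons j js)
    then show ?case
      using step[of "iter_partial js f" j]
      by (auto simp: iter_partial_def dest: has_partial_imp_partial)
  qed (simp add: iter_partial_def)
  moreover have "(\<lambda>s. g (x + s *\<^sub>R axis i 1)) differentiable (at 0)" if "g \<in> F" for g i x
    using step[OF that] by (auto simp: has_partial_def intro: differentiableI_vector)
  ultimately show ?thesis
    unfolding smooth_def using cont by blast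
qed

text \<open>The derivative of a product is a sum of products, so products alone are not closed under
  differentiation. The algebra generated by the smooth functions is, and it serves as the family in
  \<open>smooth_coinduct\<close>.\<close>

inductive_set smooth_alg :: "'n::finite signal set" where
  base: "smooth f \<Longrightarrow> f \<in> smooth_alg"
| add: "f \<in> smooth_alg \<Longrightarrow> g \<in> smooth_alg \<Longrightarrow> (\<lambda>x. f x + g x) \<in> smooth_alg"
| mult: "f \<in> smooth_alg \<Longrightarrow> g \<in> smooth_alg \<Longrightarrow> (\<lambda>x. f x * g x) \<in> smooth_alg"

lemma smooth_alg_smooth: "f \<in> smooth_alg \<Longrightarrow> smooth f"
proof (erule smooth_coinduct)
  fix f :: "'a signal" assume "f \<in> smooth_alg"
  then show "continuous_on UNIV f"
    by induction (simp_all add: smooth_imp_continuous continuous_on_add continuous_on_mult)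
next
  fix f :: "'a signal" and i assume "f \<in> smooth_alg"
  then show "\<exists>f'\<in>smooth_alg. has_partial i f f'"
  proof induction
    case (base f)
    then show ?case
      by (intro bexI[of _ "partial i f"] smooth_has_partial smooth_alg.base smooth_partial)
  next
    case (add f g)
    then obtain f' g' where "f' \<in> smooth_alg" "has_partial i f f'" "g' \<in> smooth_alg" "has_partial i g g'"
      by blast
    then show ?case
      by (intro bexI[of _ "\<lambda>x. f' x + g' x"] has_partial_add smooth_alg.add)
  next
    case (mult f g)
    then obtain f' g' where "f' \<in> smooth_alg" "has_partial i f f'" "g' \<in> smooth_alg" "has_partial i g g'"
      by blast
    with mult.hyps show ?case
      by (intro bexI[of _ "\<lambda>x. f' x * g x + f x * g' x"] has_partial_mult smooth_alg.add smooth_alg.mult)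
  qed
qed

lemma smooth_add: "smooth f \<Longrightarrow> smooth g \<Longrightarrow> smooth (\<lambda>x. f x + g x)"
  by (rule smooth_alg_smooth) (simp add: smooth_alg.base smooth_alg.add)

lemma smooth_mult: "smooth f \<Longrightarrow> smooth g \<Longrightarrow> smooth (\<lambda>x. f x * g x)"
  by (rule smooth_alg_smooth) (simp add: smooth_alg.base smooth_alg.mult)

lemma smooth_const: "smooth (\<lambda>x. c)"
  by (rule smooth_coinduct[where F = "{\<lambda>x. c, \<lambda>x. 0}"]) (auto intro: has_partial_const)

lemma smooth_sum: "(\<And>a. a \<in> S \<Longrightarrow> smooth (f a)) \<Longrightarrow> smooth (\<lambda>x. \<Sum>a\<in>S. f a x)"
  by (induction S rule: infinite_finite_induct) (auto intro: smooth_const smooth_add)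

section \<open>Symmetry of mixed partial derivatives\<close>

lemma mixed_derivatives_eq:
  fixes F :: "real \<Rightarrow> real \<Rightarrow> real"
  assumes Fs: "\<And>s t. ((\<lambda>s. F s t) has_real_derivative Fs s t) (at s)"
    and Ft: "\<And>s t. ((\<lambda>t. F s t) has_real_derivative Ft s t) (at t)"
    and Fst: "\<And>s t. ((\<lambda>t. Fs s t) has_real_derivative Fst s t) (at t)"
    and Fts: "\<And>s t. ((\<lambda>s. Ft s t) has_real_derivative Fts s t) (at s)"
    and c1: "continuous (at (0,0)) (\<lambda>(s,t). Fst s t)"
    and c2: "continuous (at (0,0)) (\<lambda>(s,t). Fts s t)"
  shows "Fst 0 0 = Fts 0 0"
proof (rule ccontr)
  assume ne: "Fst 0 0 \<noteq> Fts 0 0"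
  define e where "e = \<bar>Fst 0 0 - Fts 0 0\<bar> / 2"
  have "e > 0" using ne by (simp add: e_def)
  obtain d1 where d1: "d1 > 0" "\<And>s t. dist (s,t) (0,0) < d1 \<Longrightarrow> dist (Fst s t) (Fst 0 0) < e"
    using c1 \<open>e > 0\<close> unfolding continuous_at_eps_delta by fastforce
  obtain d2 where d2: "d2 > 0" "\<And>s t. dist (s,t) (0,0) < d2 \<Longrightarrow> dist (Fts s t) (Fts 0 0) < e"
    using c2 \<open>e > 0\<close> unfolding continuous_at_eps_delta by fastforce
  \<comment> \<open>Points of the open square with side \<open>h\<close> have distance at most
    \<open>s + t < 2 * h\<close> from the origin, hence lie in both neighbourhoods.\<close>
  define h where "h = min d1 d2 / 2"
  have h: "h > 0" "2 * h \<le> d1" "2 * h \<le> d2" using d1 d2 by (auto simp: h_def)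
  have near: "dist (s,t) (0,0) < 2 * h" if "0 < s" "s < h" "0 < t" "t < h" for s t :: real
    using that sqrt_sum_squares_le_sum[of s t] by (simp add: dist_Pair_Pair)
  \<comment> \<open>The second difference over the square. Two applications of the mean value
    theorem give \<open>h * h\<close> times a value of \<open>Fst\<close> or of \<open>Fts\<close>,
    depending on the variable treated first. The two values agree, yet each is within half the gap
    of its limit.\<close>
  define \<Delta> where "\<Delta> = F h h - F h 0 - F 0 h + F 0 0"
  obtain s where s: "0 < s" "s < h" "\<Delta> = h * (Fs s h - Fs s 0)"
    using MVT2[OF h(1), of "\<lambda>s. F s h - F s 0" "\<lambda>s. Fs s h - Fs s 0"] Fs
    by (force simp: \<Delta>_def intro!: derivative_intros)
  obtain t where t: "0 < t" "t < h" "Fs s h - Fs s 0 = h * Fst s t"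
    using MVT2[OF h(1), of "Fs s" "Fst s"] Fst by auto
  obtain t' where t': "0 < t'" "t' < h" "\<Delta> = h * (Ft h t' - Ft 0 t')"
    using MVT2[OF h(1), of "\<lambda>t. F h t - F 0 t" "\<lambda>t. Ft h t - Ft 0 t"] Ft
    by (force simp: \<Delta>_def intro!: derivative_intros)
  obtain s' where s': "0 < s'" "s' < h" "Ft h t' - Ft 0 t' = h * Fts s' t'"
    using MVT2[OF h(1), of "\<lambda>s. Ft s t'" "\<lambda>s. Fts s t'"] Fts by auto
  have eq: "Fst s t = Fts s' t'" using s(3) t(3) t'(3) s'(3) h by simp
  have "dist (Fst s t) (Fst 0 0) < e" using d1 near[of s t] s t h by force
  moreover have "dist (Fts s' t') (Fts 0 0) < e" using d2 near[of s' t'] s' t' h by force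
  moreover have "\<bar>Fst 0 0 - Fts 0 0\<bar> \<le> dist (Fst s t) (Fst 0 0) + dist (Fts s' t') (Fts 0 0)"
    using eq unfolding dist_real_def by linarith
  ultimately show False by (simp add: e_def)
qed

text \<open>The mean value theorem requires real values, so the complex signal is viewed through a
  real functional \<open>L\<close>, later \<open>Re\<close> and \<open>Im\<close>.\<close>

lemma partial_commute_component:
  fixes f :: "'n::finite signal"
  assumes f: "smooth f" and L: "bounded_linear (L :: complex \<Rightarrow> real)"
  shows "L (partial i (partial j f) x) = L (partial j (partial i f) x)"
proof -
  define P where "P = (\<lambda>s t::real. x + s *\<^sub>R axis i 1 + t *\<^sub>R axis j (1::real))"
  have Pi: "((\<lambda>s. L (g (P s t))) has_real_derivative L (partial i g (P s t))) (at s)"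
    if "smooth g" for g s t
  proof -
    have "((\<lambda>s. g (P s t)) has_vector_derivative partial i g (P s t)) (at s)"
      using has_partial_along_line[OF smooth_has_partial[OF that], of "x + t *\<^sub>R axis j 1" i s]
      by (simp add: P_def algebra_simps)
    from bounded_linear.has_vector_derivative[OF L this] show ?thesis
      by (simp add: has_real_derivative_iff_has_vector_derivative)
  qed
  have Pj: "((\<lambda>t. L (g (P s t))) has_real_derivative L (partial j g (P s t))) (at t)"
    if "smooth g" for g s t
  proof -
    have "((\<lambda>t. g (P s t)) has_vector_derivative partial j g (P s t)) (at t)"
      using has_partial_along_line[OF smooth_has_partial[OF that], of "x + s *\<^sub>R axis i 1" j t]
      by (simp add: P_def algebra_simps)
    from bounded_linear.has_vector_derivative[OF L this] show ?thesis
      by (simp add: has_real_derivative_iff_has_vector_derivative)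
  qed
  have cont: "continuous (at (0,0)) (\<lambda>(s,t). L (g (P s t)))" if "smooth g" for g
  proof -
    have "continuous_on UNIV (\<lambda>z. g (P (fst z) (snd z)))"
      unfolding P_def
      by (rule continuous_on_compose2[OF smooth_imp_continuous[OF that]]) (auto intro!: continuous_intros)
    from bounded_linear.continuous_on[OF L this] show ?thesis
      by (simp add: case_prod_unfold continuous_on_eq_continuous_at)
  qed
  have "L (partial j (partial i f) (P 0 0)) = L (partial i (partial j f) (P 0 0))"
    by (rule mixed_derivatives_eq[where F = "\<lambda>s t. L (f (P s t))" and Fs = "\<lambda>s t. L (partial i f (P s t))"
          and Ft = "\<lambda>s t. L (partial j f (P s t))" and Fst = "\<lambda>s t. L (partial j (partial i f) (P s t))"
          and Fts = "\<lambda>s t. L (partial i (partial j f) (P s t))"])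
      (auto intro!: Pi Pj cont smooth_partial f)
  then show ?thesis by (simp add: P_def)
qed

lemma partial_commute: "smooth f \<Longrightarrow> partial i (partial j f) = partial j (partial i f)"
  by (intro ext complex_eqI partial_commute_component bounded_linear_Re bounded_linear_Im)

lemma iter_partial_append: "iter_partial (xs @ ys) f = iter_partial xs (iter_partial ys f)"
  by (simp add: iter_partial_def)

lemma iter_partial_Cons: "iter_partial (i # xs) f = partial i (iter_partial xs f)"
  by (simp add: iter_partial_def)

lemma iter_partial_move:
  assumes "smooth f"
  shows "iter_partial (ys @ i # zs) f = iter_partial (i # ys @ zs) f"
proof (induction ys)
  case (Cons y ys)
  then show ?case
    using partial_commute[OF smooth_iter_partial[OF assms], of y i "ys @ zs"]
    by (simp add: iter_partial_Cons)
qed simp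

lemma iter_partial_mset:
  assumes "smooth f" "mset xs = mset ys"
  shows "iter_partial xs f = iter_partial ys f"
  using assms(2)
proof (induction xs arbitrary: ys)
  case (Cons x xs)
  then have "x \<in> set ys" by (metis list.set_intros(1) set_mset_mset)
  then obtain us vs where ys: "ys = us @ x # vs" by (meson split_list)
  with Cons.prems have "mset xs = mset (us @ vs)" by simp
  from Cons.IH[OF this] show ?case
    using iter_partial_move[OF assms(1), of us x vs] by (simp add: ys iter_partial_Cons)
qed simp

section \<open>Derivatives indexed by multi-indices\<close>

definition index_list :: "('n::finite \<Rightarrow> nat) \<Rightarrow> 'n list" where
  "index_list \<beta> = concat (map (\<lambda>i. replicate (\<beta> i) i) var_list)"

lemma dpow_index_list: "dpow \<beta> f = iter_partial (index_list \<beta>) f"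
  by (simp add: dpow_def index_list_def)

lemma var_list: "distinct (var_list :: 'n::finite list)" "set (var_list :: 'n list) = UNIV"
proof -
  have "\<exists>xs::'n list. distinct xs \<and> set xs = UNIV"
    using finite_distinct_list[OF finite_class.finite_UNIV] by blast
  from someI_ex[OF this] show "distinct (var_list :: 'n::finite list)" "set (var_list :: 'n list) = UNIV"
    by (auto simp: var_list_def)
qed

lemma count_index_list: "count (mset (index_list \<beta>)) i = \<beta> i"
proof -
  have "count (mset (concat (map (\<lambda>i. replicate (\<beta> i) i) xs))) i = (if i \<in> set xs then \<beta> i else 0)"
    if "distinct xs" for xs
    using that by (induction xs) auto
  then show ?thesis by (simp add: index_list_def var_list)
qed

text \<open>\<open>var_list\<close> is an unspecified enumeration, so the list inside
  \<open>dpow\<close> is known only up to order. By symmetry of derivatives, any list with the right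
  multiplicities computes the same function.\<close>

lemma dpow_eq_iter_partial:
  assumes "smooth f" "\<And>i. count (mset xs) i = \<beta> i"
  shows "dpow \<beta> f = iter_partial xs f"
  unfolding dpow_index_list
  by (rule iter_partial_mset[OF assms(1)]) (simp add: multiset_eq_iff count_index_list assms(2))

lemma dpow_zero:
  fixes f :: "'n::finite signal"
  shows "dpow (\<lambda>_. 0) f = f"
proof -
  have "index_list (\<lambda>_. 0) = ([] :: 'n list)" by (simp add: index_list_def)
  then show ?thesis by (simp add: dpow_index_list iter_partial_def)
qed

lemma dpow_Suc:
  assumes "smooth f"
  shows "dpow (\<beta>(i := Suc (\<beta> i))) f = partial i (dpow \<beta> f)"
proof -
  have "dpow (\<beta>(i := Suc (\<beta> i))) f = iter_partial (i # index_list \<beta>) f"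
    by (rule dpow_eq_iter_partial[OF assms]) (simp add: count_index_list)
  then show ?thesis by (simp add: iter_partial_Cons dpow_index_list)
qed

lemma dpow_dpow:
  assumes "smooth f"
  shows "dpow \<beta> (dpow \<gamma> f) = dpow (\<lambda>i. \<beta> i + \<gamma> i) f"
proof -
  have "dpow (\<lambda>i. \<beta> i + \<gamma> i) f = iter_partial (index_list \<beta> @ index_list \<gamma>) f"
    by (rule dpow_eq_iter_partial[OF assms]) (simp add: count_index_list)
  then show ?thesis by (simp add: iter_partial_append dpow_index_list)
qed

lemma smooth_dpow: "smooth f \<Longrightarrow> smooth (dpow \<beta> f)"
  by (simp add: dpow_index_list smooth_iter_partial)

subsection \<open>Leibniz rule\<close>

text \<open>Induction on the total degree. Raising a single entry corresponds to one further partial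
  derivative, by \<open>dpow_Suc\<close>.\<close>

lemma multi_index_induct [case_names zero Suc]:
  fixes \<beta> :: "'n::finite \<Rightarrow> nat"
  assumes "P (\<lambda>_. 0)" "\<And>\<beta> i. P \<beta> \<Longrightarrow> P (\<beta>(i := Suc (\<beta> i)))"
  shows "P \<beta>"
proof (induction "sum \<beta> UNIV" arbitrary: \<beta>)
  case 0
  then have "\<beta> = (\<lambda>_. 0)" by (simp add: fun_eq_iff)
  with assms(1) show ?case by simp
next
  case (Suc n)
  then obtain i where i: "\<beta> i \<noteq> 0" by (metis Zero_not_Suc sum.neutral)
  define \<gamma> where "\<gamma> = \<beta>(i := \<beta> i - 1)"
  have "sum \<beta> UNIV = \<beta> i + sum \<beta> (UNIV - {i})" "sum \<gamma> UNIV = \<gamma> i + sum \<gamma> (UNIV - {i})"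
    by (simp_all add: sum.remove)
  moreover have "sum \<gamma> (UNIV - {i}) = sum \<beta> (UNIV - {i})"
    by (rule sum.cong) (auto simp: \<gamma>_def)
  ultimately have "n = sum \<gamma> UNIV" using i Suc.hyps(2) by (simp add: \<gamma>_def)
  from assms(2)[OF Suc.hyps(1)[OF this], of i] show ?case
    using i by (simp add: \<gamma>_def)
qed

lemma finite_multi_index_le: "finite {\<kappa>::'n::finite \<Rightarrow> nat. \<forall>i. \<kappa> i \<le> \<beta> i}"
proof -
  have "{\<kappa>::'n \<Rightarrow> nat. \<forall>i. \<kappa> i \<le> \<beta> i} = PiE UNIV (\<lambda>i. {..\<beta> i})"
    by (auto simp: PiE_def Pi_def)
  then show ?thesis by (simp add: finite_PiE)
qed

definition mbinom :: "('n::finite \<Rightarrow> nat) \<Rightarrow> ('n \<Rightarrow> nat) \<Rightarrow> complex" where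
  "mbinom \<beta> \<kappa> = (\<Prod>i\<in>UNIV. of_nat (\<beta> i choose \<kappa> i))"

lemma mbinom_eq_0: "\<not> \<kappa> i \<le> \<beta> i \<Longrightarrow> mbinom \<beta> \<kappa> = 0"
  unfolding mbinom_def by (rule prod_zero) (auto simp: not_le intro: exI[of _ i])

lemma mbinom_Suc:
  "mbinom (\<beta>(i := Suc (\<beta> i))) \<kappa>
     = mbinom \<beta> \<kappa> + (if \<kappa> i = 0 then 0 else mbinom \<beta> (\<kappa>(i := \<kappa> i - 1)))"
proof -
  have *: "mbinom \<alpha> \<gamma> = of_nat (\<alpha> i choose \<gamma> i) * (\<Prod>j\<in>UNIV - {i}. of_nat (\<alpha> j choose \<gamma> j))" for \<alpha> \<gamma>
    unfolding mbinom_def by (rule prod.remove) auto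
  have "(\<Prod>j\<in>UNIV - {i}. of_nat ((\<beta>(i := Suc (\<beta> i))) j choose \<kappa> j))
      = (\<Prod>j\<in>UNIV - {i}. of_nat (\<beta> j choose \<kappa> j) :: complex)"
    by (rule prod.cong) auto
  moreover have "(\<Prod>j\<in>UNIV - {i}. of_nat (\<beta> j choose (\<kappa>(i := \<kappa> i - 1)) j))
      = (\<Prod>j\<in>UNIV - {i}. of_nat (\<beta> j choose \<kappa> j) :: complex)"
    by (rule prod.cong) auto
  ultimately show ?thesis
    by (cases "\<kappa> i") (simp_all add: * algebra_simps)
qed

text \<open>The combinatorial half of the Leibniz rule: Pascal's rule in coordinate \<open>i\<close>
  matches the two terms that the product rule makes of each summand. Keeping \<open>G\<close>
  arbitrary separates this from the analysis.\<close>

lemma sum_mbinom_Suc: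
  "(\<Sum>\<kappa>\<in>{\<kappa>. \<forall>j. \<kappa> j \<le> (\<beta>(i := Suc (\<beta> i))) j}. mbinom (\<beta>(i := Suc (\<beta> i))) \<kappa> * G \<kappa>)
     = (\<Sum>\<kappa>\<in>{\<kappa>. \<forall>j. \<kappa> j \<le> \<beta> j}. mbinom \<beta> \<kappa> * (G \<kappa> + G (\<kappa>(i := Suc (\<kappa> i)))))"
proof -
  let ?\<beta>' = "\<beta>(i := Suc (\<beta> i))"
  let ?S' = "{\<kappa>. \<forall>j. \<kappa> j \<le> ?\<beta>' j}" and ?S = "{\<kappa>. \<forall>j. \<kappa> j \<le> \<beta> j}"
  have "(\<Sum>\<kappa>\<in>?S'. mbinom ?\<beta>' \<kappa> * G \<kappa>) = (\<Sum>\<kappa>\<in>?S'. mbinom \<beta> \<kappa> * G \<kappa>)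
      + (\<Sum>\<kappa>\<in>?S'. if \<kappa> i = 0 then 0 else mbinom \<beta> (\<kappa>(i := \<kappa> i - 1)) * G \<kappa>)"
    unfolding sum.distrib[symmetric]
    by (rule sum.cong[OF refl]) (simp add: mbinom_Suc distrib_right)
  \<comment> \<open>The extra indices have \<open>\<kappa> i = Suc (\<beta> i)\<close>, where the
    binomial coefficient vanishes.\<close>
  also have "(\<Sum>\<kappa>\<in>?S'. mbinom \<beta> \<kappa> * G \<kappa>) = (\<Sum>\<kappa>\<in>?S. mbinom \<beta> \<kappa> * G \<kappa>)"
  proof (rule sum.mono_neutral_right)
    show "?S \<subseteq> ?S'" by (auto simp: le_SucI)
    show "\<forall>\<kappa>\<in>?S' - ?S. mbinom \<beta> \<kappa> * G \<kappa> = 0" using mbinom_eq_0 by auto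
  qed (rule finite_multi_index_le)
  also have "(\<Sum>\<kappa>\<in>?S'. if \<kappa> i = 0 then 0 else mbinom \<beta> (\<kappa>(i := \<kappa> i - 1)) * G \<kappa>)
      = (\<Sum>\<kappa>\<in>{\<kappa>\<in>?S'. \<kappa> i \<noteq> 0}. mbinom \<beta> (\<kappa>(i := \<kappa> i - 1)) * G \<kappa>)"
    by (rule sum.mono_neutral_cong_right) (auto simp: finite_multi_index_le simp del: fun_upd_apply)
  also have "\<dots> = (\<Sum>\<kappa>\<in>?S. mbinom \<beta> \<kappa> * G (\<kappa>(i := Suc (\<kappa> i))))"
  proof (rule sum.reindex_bij_witness[where i = "\<lambda>\<kappa>. \<kappa>(i := Suc (\<kappa> i))" and j = "\<lambda>\<kappa>. \<kappa>(i := \<kappa> i - 1)"])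
    fix \<kappa> assume "\<kappa> \<in> {\<kappa>\<in>?S'. \<kappa> i \<noteq> 0}"
    then have k: "\<And>j. \<kappa> j \<le> ?\<beta>' j" "\<kappa> i \<noteq> 0" by blast+
    show "(\<kappa>(i := \<kappa> i - 1))(i := Suc ((\<kappa>(i := \<kappa> i - 1)) i)) = \<kappa>" using k by auto
    show "\<kappa>(i := \<kappa> i - 1) \<in> ?S" using k(1)[unfolded fun_upd_apply] by (force split: if_splits)
    from k show "mbinom \<beta> (\<kappa>(i := \<kappa> i - 1)) * G ((\<kappa>(i := \<kappa> i - 1))(i := Suc ((\<kappa>(i := \<kappa> i - 1)) i)))
       = mbinom \<beta> (\<kappa>(i := \<kappa> i - 1)) * G \<kappa>" by simp
  qed auto
  finally show ?thesis by (simp only: sum.distrib distrib_left)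
qed

lemma has_partial_sum:
  "(\<And>a. a \<in> S \<Longrightarrow> has_partial i (f a) (f' a)) \<Longrightarrow>
    has_partial i (\<lambda>x. \<Sum>a\<in>S. f a x) (\<lambda>x. \<Sum>a\<in>S. f' a x)"
  by (induction S rule: infinite_finite_induct) (simp_all add: has_partial_const has_partial_add)

lemma has_partial_cmult:
  "has_partial i f f' \<Longrightarrow> has_partial i (\<lambda>x. c * f x) (\<lambda>x. c * f' x)"
  using has_partial_mult[OF has_partial_const, of i f f' c] by simp

lemma has_partial_dpow: "smooth f \<Longrightarrow> has_partial i (dpow \<beta> f) (dpow (\<beta>(i := Suc (\<beta> i))) f)"
  using smooth_has_partial[OF smooth_dpow] by (simp add: dpow_Suc)

lemma dpow_mult:
  assumes u: "smooth u" and f: "smooth f"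
  shows "dpow \<beta> (\<lambda>x. u x * f x)
    = (\<lambda>x. \<Sum>\<kappa>\<in>{\<kappa>. \<forall>j. \<kappa> j \<le> \<beta> j}. mbinom \<beta> \<kappa> * (dpow \<kappa> u x * dpow (\<lambda>j. \<beta> j - \<kappa> j) f x))"
proof (induction \<beta> rule: multi_index_induct)
  case zero
  have "{\<kappa>::'a \<Rightarrow> nat. \<forall>j. \<kappa> j = 0} = {\<lambda>_. 0}" by auto
  then show ?case by (simp add: dpow_zero mbinom_def)
next
  case (Suc \<beta> i)
  let ?\<beta>' = "\<beta>(i := Suc (\<beta> i))"
  define G where "G = (\<lambda>\<kappa> x. dpow \<kappa> u x * dpow (\<lambda>j. ?\<beta>' j - \<kappa> j) f x)"
  have "has_partial i
     (\<lambda>x. \<Sum>\<kappa>\<in>{\<kappa>. \<forall>j. \<kappa> j \<le> \<beta> j}. mbinom \<beta> \<kappa> * (dpow \<kappa> u x * dpow (\<lambda>j. \<beta> j - \<kappa> j) f x))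
     (\<lambda>x. \<Sum>\<kappa>\<in>{\<kappa>. \<forall>j. \<kappa> j \<le> \<beta> j}. mbinom \<beta> \<kappa> * (G \<kappa> x + G (\<kappa>(i := Suc (\<kappa> i))) x))"
  proof (intro has_partial_sum has_partial_cmult)
    fix \<kappa> assume "\<kappa> \<in> {\<kappa>. \<forall>j. \<kappa> j \<le> \<beta> j}"
    then have k: "\<kappa> j \<le> \<beta> j" for j by auto
    have 1: "(\<lambda>j. ?\<beta>' j - (\<kappa>(i := Suc (\<kappa> i))) j) = (\<lambda>j. \<beta> j - \<kappa> j)" by auto
    \<comment> \<open>Subtraction is truncated; the bound \<open>\<kappa> i \<le> \<beta> i\<close>
      lets the successor pass through it.\<close>
    have 2: "(\<lambda>j. \<beta> j - \<kappa> j)(i := Suc (\<beta> i - \<kappa> i)) = (\<lambda>j. ?\<beta>' j - \<kappa> j)"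
      using k by (auto simp: Suc_diff_le)
    show "has_partial i (\<lambda>x. dpow \<kappa> u x * dpow (\<lambda>j. \<beta> j - \<kappa> j) f x)
        (\<lambda>x. G \<kappa> x + G (\<kappa>(i := Suc (\<kappa> i))) x)"
      using has_partial_mult[OF has_partial_dpow[OF u, of i \<kappa>] has_partial_dpow[OF f, of i "\<lambda>j. \<beta> j - \<kappa> j"]]
      unfolding G_def 1 2 by (simp add: add.commute)
  qed
  from has_partial_imp_partial[OF this]
  have "dpow ?\<beta>' (\<lambda>x. u x * f x) =
      (\<lambda>x. \<Sum>\<kappa>\<in>{\<kappa>. \<forall>j. \<kappa> j \<le> \<beta> j}. mbinom \<beta> \<kappa> * (G \<kappa> x + G (\<kappa>(i := Suc (\<kappa> i))) x))"
    by (simp only: dpow_Suc[OF smooth_mult[OF u f]] Suc)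
  moreover have "(\<Sum>\<kappa>\<in>{\<kappa>. \<forall>j. \<kappa> j \<le> ?\<beta>' j}. mbinom ?\<beta>' \<kappa> * G \<kappa> x)
      = (\<Sum>\<kappa>\<in>{\<kappa>. \<forall>j. \<kappa> j \<le> \<beta> j}. mbinom \<beta> \<kappa> * (G \<kappa> x + G (\<kappa>(i := Suc (\<kappa> i))) x))" for x
    by (rule sum_mbinom_Suc)
  ultimately show ?case by (simp only: G_def)
qed

lemma dpow_sum:
  assumes "\<And>a. a \<in> S \<Longrightarrow> smooth (f a)"
  shows "dpow \<beta> (\<lambda>x. \<Sum>a\<in>S. c a * f a x) = (\<lambda>x. \<Sum>a\<in>S. c a * dpow \<beta> (f a) x)"
proof (induction \<beta> rule: multi_index_induct)
  case (Suc \<beta> i)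
  have "smooth (\<lambda>x. \<Sum>a\<in>S. c a * f a x)"
    using assms by (intro smooth_sum smooth_mult smooth_const)
  moreover have "has_partial i (\<lambda>x. \<Sum>a\<in>S. c a * dpow \<beta> (f a) x)
      (\<lambda>x. \<Sum>a\<in>S. c a * dpow (\<beta>(i := Suc (\<beta> i))) (f a) x)"
    using assms by (intro has_partial_sum has_partial_cmult has_partial_dpow)
  ultimately show ?case
    by (simp only: dpow_Suc Suc has_partial_imp_partial)
qed (simp add: dpow_zero)

subsection \<open>Polynomials and exponentials\<close>

text \<open>Polynomial functions are given by generators instead of coefficients, so that
  differentiability and restriction to lines become rule inductions without bookkeeping of
  supports.\<close>

inductive_set poly_funs :: "'n::finite signal set" where
  const: "(\<lambda>x. c) \<in> poly_funs"
| coord: "(\<lambda>x. complex_of_real (x $ i)) \<in> poly_funs"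
| add: "f \<in> poly_funs \<Longrightarrow> g \<in> poly_funs \<Longrightarrow> (\<lambda>x. f x + g x) \<in> poly_funs"
| mult: "f \<in> poly_funs \<Longrightarrow> g \<in> poly_funs \<Longrightarrow> (\<lambda>x. f x * g x) \<in> poly_funs"

lemma poly_funs_sum: "(\<And>a. a \<in> S \<Longrightarrow> f a \<in> poly_funs) \<Longrightarrow> (\<lambda>x. \<Sum>a\<in>S. f a x) \<in> poly_funs"
  by (induction S rule: infinite_finite_induct) (simp_all add: poly_funs.const poly_funs.add)

lemma poly_funs_prod: "(\<And>a. a \<in> S \<Longrightarrow> f a \<in> poly_funs) \<Longrightarrow> (\<lambda>x. \<Prod>a\<in>S. f a x) \<in> poly_funs"
  by (induction S rule: infinite_finite_induct) (simp_all add: poly_funs.const poly_funs.mult)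

lemma poly_funs_power: "f \<in> poly_funs \<Longrightarrow> (\<lambda>x. f x ^ k) \<in> poly_funs"
  by (induction k) (simp_all add: poly_funs.const poly_funs.mult)

lemma monval_poly_funs: "monval \<alpha> \<in> poly_funs"
proof -
  have "(\<lambda>x. monval \<alpha> x) \<in> poly_funs"
    unfolding monval_def by (intro poly_funs_prod poly_funs_power poly_funs.coord)
  then show ?thesis by simp
qed

lemma poly_fun_poly_funs: "poly_fun p \<in> poly_funs"
proof -
  have "(\<lambda>x. poly_fun p x) \<in> poly_funs"
    unfolding poly_fun_def
    by (intro poly_funs_sum poly_funs.mult poly_funs.const) (simp add: monval_poly_funs)
  then show ?thesis by simp
qed

lemma poly_funs_partial: "f \<in> poly_funs \<Longrightarrow> \<exists>f'\<in>poly_funs. has_partial i f f'"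
proof (induction rule: poly_funs.induct)
  case (const c)
  show ?case by (intro bexI[of _ "\<lambda>x. 0"] has_partial_const poly_funs.const)
next
  case (coord j)
  have "has_partial i (\<lambda>x. complex_of_real (x $ j)) (\<lambda>x. if i = j then 1 else 0)"
    unfolding has_partial_def
    by (auto simp: axis_def intro!: derivative_eq_intros)
  then show ?case by (intro bexI[of _ "\<lambda>x. if i = j then 1 else 0"] poly_funs.const)
next
  case (add f g)
  then obtain f' g' where "f' \<in> poly_funs" "has_partial i f f'" "g' \<in> poly_funs" "has_partial i g g'"
    by blast
  then show ?case
    by (intro bexI[of _ "\<lambda>x. f' x + g' x"] has_partial_add poly_funs.add)
next
  case (mult f g)
  then obtain f' g' where "f' \<in> poly_funs" "has_partial i f f'" "g' \<in> poly_funs" "has_partial i g g'"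
    by blast
  with mult.hyps show ?case
    by (intro bexI[of _ "\<lambda>x. f' x * g x + f x * g' x"] has_partial_mult poly_funs.add poly_funs.mult)
qed

lemma poly_funs_continuous: "f \<in> poly_funs \<Longrightarrow> continuous_on UNIV f"
proof (induction rule: poly_funs.induct)
  case (coord i)
  show ?case by (intro continuous_intros)
qed (simp_all add: continuous_on_add continuous_on_mult)

lemma poly_funs_smooth: "f \<in> poly_funs \<Longrightarrow> smooth f"
  by (erule smooth_coinduct) (auto intro: poly_funs_continuous poly_funs_partial)

lemma poly_funs_dpow: "f \<in> poly_funs \<Longrightarrow> dpow \<beta> f \<in> poly_funs"
proof (induction \<beta> rule: multi_index_induct)
  case (Suc \<beta> i)
  then show ?case
    using poly_funs_partial[of "dpow \<beta> f" i]
    by (auto simp: dpow_Suc poly_funs_smooth simp del: fun_upd_apply dest: has_partial_imp_partial)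
qed (simp add: dpow_zero)

lemma poly_funs_act: "f \<in> poly_funs \<Longrightarrow> act w f \<in> poly_funs"
proof -
  assume "f \<in> poly_funs"
  then have "(\<lambda>x. act w f x) \<in> poly_funs"
    unfolding act_def
    by (intro poly_funs_sum poly_funs.mult poly_funs.const)
      (simp_all add: monval_poly_funs poly_funs_dpow)
  then show ?thesis by simp
qed

text \<open>The bridge to one-variable algebra: the independence argument works with
  \<open>degree\<close> and \<open>pderiv\<close> of the polynomial obtained on a line.\<close>

lemma poly_funs_along_line:
  "f \<in> poly_funs \<Longrightarrow> \<exists>q. \<forall>s::real. f (x + s *\<^sub>R v) = poly q (complex_of_real s)"
proof (induction rule: poly_funs.induct)
  case (const c)
  show ?case by (rule exI[of _ "[:c:]"]) simp
next
  case (coord i)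
  show ?case by (rule exI[of _ "[:of_real (x $ i), of_real (v $ i):]"]) simp
next
  case (add f g)
  then show ?case by (metis poly_add)
next
  case (mult f g)
  then show ?case by (metis poly_mult)
qed

section \<open>Derivatives of exponentials and monomials\<close>

lemma exp_fun_along_axis:
  "exp_fun lam (x + s *\<^sub>R axis i 1) = exp_fun lam x * exp (lam i * of_real s)"
proof -
  have "(\<Sum>j\<in>UNIV. lam j * complex_of_real (s * (axis i 1 $ j))) = lam i * of_real s"
    by (subst sum.remove[of _ i]) (auto simp: axis_def intro!: sum.neutral)
  then show ?thesis
    by (simp add: exp_fun_def exp_add[symmetric] algebra_simps sum.distrib)
qed

lemma has_partial_exp_fun: "has_partial i (exp_fun lam) (\<lambda>x. lam i * exp_fun lam x)"
  unfolding has_partial_def exp_fun_along_axis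
  by (intro allI has_vector_derivative_real_field) (auto intro!: derivative_eq_intros)

lemma smooth_exp_fun: "smooth (exp_fun lam)"
\<comment> \<open>Differentiation multiplies \<open>exp_fun lam\<close> by a constant, so its scalar
  multiples form a closed family.\<close>
proof (rule smooth_coinduct[where F = "{\<lambda>x. c * exp_fun lam x |c. True}"])
  show "exp_fun lam \<in> {\<lambda>x. c * exp_fun lam x |c. True}"
    by (auto intro!: exI[of _ 1])
  fix f assume "f \<in> {\<lambda>x. c * exp_fun lam x |c. True}"
  then obtain c where f: "f = (\<lambda>x. c * exp_fun lam x)" by blast
  have "continuous_on UNIV (\<lambda>x. exp_fun lam x)"
    unfolding exp_fun_def by (intro continuous_intros)
  then show "continuous_on UNIV f" by (simp add: f continuous_on_mult)
  show "\<exists>f'\<in>{\<lambda>x. c * exp_fun lam x |c. True}. has_partial i f f'" for i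
    using has_partial_cmult[OF has_partial_exp_fun, where c = c] unfolding f
    by (intro bexI) (auto simp: mult.assoc[symmetric])
qed

lemma dpow_exp_fun: "dpow \<beta> (exp_fun lam) = (\<lambda>x. (\<Prod>j\<in>UNIV. lam j ^ \<beta> j) * exp_fun lam x)"
proof (induction \<beta> rule: multi_index_induct)
  case (Suc \<beta> i)
  have "(\<Prod>j\<in>UNIV. lam j ^ (\<beta>(i := Suc (\<beta> i))) j) = lam i * (\<Prod>j\<in>UNIV. lam j ^ \<beta> j)"
    by (subst (1 2) prod.remove[of _ i]) (auto intro: prod.cong)
  then show ?case
    using has_partial_imp_partial[OF has_partial_cmult[OF has_partial_exp_fun[of i lam], where c = "\<Prod>j\<in>UNIV. lam j ^ \<beta> j"]]
    by (simp add: dpow_Suc smooth_exp_fun Suc del: fun_upd_apply) (simp add: mult_ac)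
qed (simp add: dpow_zero)

text \<open>Truncated subtraction makes \<open>ffact g k\<close> vanish for \<open>k > g\<close>.\<close>

definition ffact :: "nat \<Rightarrow> nat \<Rightarrow> complex" where
  "ffact g k = (\<Prod>l<k. of_nat (g - l))"

text \<open>Turns the falling factorials that arise from differentiating monomials into the
  quotients of factorials in \<open>weyl_mult\<close>.\<close>

lemma ffact_eq: "k \<le> g \<Longrightarrow> ffact g k = of_nat (fact g) / of_nat (fact (g - k))"
proof (induction k)
  case (Suc k)
  then have "fact (g - k) = (g - k) * fact (g - Suc k)"
    by (metis Suc_diff_Suc Suc_le_lessD fact_Suc of_nat_id)
  moreover have "g - k \<noteq> 0" using Suc.prems by simp
  ultimately show ?case using Suc by (simp add: ffact_def field_simps del: of_nat_fact)
qed (simp add: ffact_def)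

lemma ffact_eq_0: "\<not> k \<le> g \<Longrightarrow> ffact g k = 0"
  unfolding ffact_def by (rule prod_zero) (auto intro!: bexI[of _ g])

text \<open>For \<open>\<alpha> i = 0\<close> the truncated exponent is harmless, since the factor
  \<open>of_nat (\<alpha> i)\<close> vanishes.\<close>

lemma has_partial_monval:
  "has_partial i (monval \<alpha>) (\<lambda>x. of_nat (\<alpha> i) * monval (\<alpha>(i := \<alpha> i - 1)) x)"
  unfolding has_partial_def
proof
  fix x :: "real^'a"
  define C where "C = (\<Prod>j\<in>UNIV - {i}. complex_of_real (x $ j) ^ \<alpha> j)"
  have 1: "monval \<alpha> (x + s *\<^sub>R axis i 1) = (of_real (x $ i) + of_real s) ^ \<alpha> i * C" for s
    unfolding monval_def C_def
    by (subst prod.remove[of _ i]) (auto simp: axis_def intro!: prod.cong)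
  have 2: "monval (\<alpha>(i := \<alpha> i - 1)) x = of_real (x $ i) ^ (\<alpha> i - 1) * C"
    unfolding monval_def C_def
    by (subst prod.remove[of _ i]) (auto intro!: prod.cong)
  have "((\<lambda>s. (of_real (x $ i) + s) ^ \<alpha> i * C) has_field_derivative
        of_nat (\<alpha> i) * (of_real (x $ i) ^ (\<alpha> i - 1) * C)) (at (complex_of_real 0))"
    by (auto intro!: derivative_eq_intros)
  then show "((\<lambda>s. monval \<alpha> (x + s *\<^sub>R axis i 1)) has_vector_derivative
      of_nat (\<alpha> i) * monval (\<alpha>(i := \<alpha> i - 1)) x) (at 0)"
    unfolding 1 2 by (rule has_vector_derivative_real_field)
qed

lemma dpow_monval:
  "dpow \<kappa> (monval \<gamma>) = (\<lambda>x. (\<Prod>j\<in>UNIV. ffact (\<gamma> j) (\<kappa> j)) * monval (\<lambda>j. \<gamma> j - \<kappa> j) x)"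
proof (induction \<kappa> rule: multi_index_induct)
  case zero
  then show ?case by (simp add: dpow_zero ffact_def)
next
  case (Suc \<kappa> i)
  have 1: "(\<Prod>j\<in>UNIV. ffact (\<gamma> j) ((\<kappa>(i := Suc (\<kappa> i))) j))
      = of_nat (\<gamma> i - \<kappa> i) * (\<Prod>j\<in>UNIV. ffact (\<gamma> j) (\<kappa> j))"
    by (subst (1 2) prod.remove[of _ i]) (auto simp: ffact_def intro: prod.cong)
  have 2: "(\<lambda>j. \<gamma> j - (\<kappa>(i := Suc (\<kappa> i))) j) = (\<lambda>j. \<gamma> j - \<kappa> j)(i := \<gamma> i - \<kappa> i - 1)"
    by auto
  show ?case
    using has_partial_imp_partial[OF has_partial_cmult[OF has_partial_monval[of i "\<lambda>j. \<gamma> j - \<kappa> j"],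
          where c = "\<Prod>j\<in>UNIV. ffact (\<gamma> j) (\<kappa> j)"]]
    unfolding 1 2 dpow_Suc[OF poly_funs_smooth[OF monval_poly_funs]] Suc
    by (simp add: mult_ac)
qed

lemma monval_add: "monval \<alpha> x * monval \<beta> x = monval (\<lambda>i. \<alpha> i + \<beta> i) x"
  by (simp add: monval_def power_add prod.distrib)

subsection \<open>Action of the Weyl algebra\<close>

text \<open>Sums of operators mix different supports and may cancel; enlarging the range of
  summation allows them to be compared over one common index set.\<close>

lemma act_superset:
  assumes "finite S" "{c. w c \<noteq> 0} \<subseteq> S"
  shows "act w f x = (\<Sum>c\<in>S. w c * monval (fst c) x * dpow (snd c) f x)"
  unfolding act_def by (rule sum.mono_neutral_left) (use assms in auto)

text \<open>The inner sum is the coefficient function of a formal sum of monomials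
  \<open>g s\<close> with weights \<open>k s\<close>. Since \<open>g\<close> need not be injective,
  collisions add up. Both \<open>weyl_mult\<close> and \<open>sigma\<close> have this shape, and
  \<open>act_combination\<close> evaluates it term by term.\<close>

lemma sum_single_swap:
  fixes h :: "'c \<Rightarrow> complex"
  assumes "finite S"
  shows "(\<Sum>c\<in>g ` S. (\<Sum>s\<in>S. if c = g s then k s else 0) * h c) = (\<Sum>s\<in>S. k s * h (g s))"
proof -
  have "(\<Sum>c\<in>g ` S. (\<Sum>s\<in>S. if c = g s then k s else 0) * h c)
      = (\<Sum>s\<in>S. \<Sum>c\<in>g ` S. if c = g s then k s * h c else 0)"
    by (subst sum.swap) (auto simp: sum_distrib_right intro!: sum.cong)
  also have "\<dots> = (\<Sum>s\<in>S. k s * h (g s))"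
    using assms by (intro sum.cong) (auto simp: sum.delta')
  finally show ?thesis .
qed

lemma combination_support:
  "{c. (\<Sum>s\<in>S. if c = g s then k s else 0) \<noteq> (0::complex)} \<subseteq> g ` S"
proof
  fix c assume "c \<in> {c. (\<Sum>s\<in>S. if c = g s then k s else 0) \<noteq> 0}"
  then have "(\<Sum>s\<in>S. if c = g s then k s else 0) \<noteq> 0" by simp
  then obtain s where "s \<in> S" "(if c = g s then k s else 0) \<noteq> 0"
    by (rule sum.not_neutral_contains_not_neutral)
  then show "c \<in> g ` S" by (auto split: if_splits)
qed

lemma act_combination:
  assumes "finite S"
  shows "act (\<lambda>c. \<Sum>s\<in>S. if c = g s then k s else 0) f x
    = (\<Sum>s\<in>S. k s * monval (fst (g s)) x * dpow (snd (g s)) f x)"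
  using sum_single_swap[OF assms, of g k "\<lambda>c. monval (fst c) x * dpow (snd c) f x"]
  by (subst act_superset[OF finite_imageI[OF assms] combination_support]) (simp add: mult.assoc)

lemma is_weyl_combination:
  "finite S \<Longrightarrow> is_weyl (\<lambda>c. \<Sum>s\<in>S. if c = g s then k s else 0)"
  unfolding is_weyl_def by (rule finite_subset[OF combination_support]) simp

lemma act_sum:
  assumes "finite S" "\<And>s. s \<in> S \<Longrightarrow> is_weyl (w s)"
  shows "act (\<lambda>c. \<Sum>s\<in>S. w s c) f x = (\<Sum>s\<in>S. act (w s) f x)"
proof -
  let ?T = "\<Union>s\<in>S. {c. w s c \<noteq> 0}"
  have fin: "finite ?T" using assms by (auto simp: is_weyl_def)
  have "act (\<lambda>c. \<Sum>s\<in>S. w s c) f x = (\<Sum>c\<in>?T. (\<Sum>s\<in>S. w s c) * monval (fst c) x * dpow (snd c) f x)"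
    by (rule act_superset[OF fin]) (auto elim: sum.not_neutral_contains_not_neutral)
  also have "\<dots> = (\<Sum>s\<in>S. \<Sum>c\<in>?T. w s c * monval (fst c) x * dpow (snd c) f x)"
    by (subst sum.swap) (simp add: sum_distrib_right)
  also have "\<dots> = (\<Sum>s\<in>S. act (w s) f x)"
    by (intro sum.cong refl act_superset[OF fin, symmetric]) auto
  finally show ?thesis .
qed

lemma smooth_act: "smooth f \<Longrightarrow> smooth (act w f)"
proof -
  assume "smooth f"
  then have "smooth (\<lambda>x. act w f x)"
    unfolding act_def
    by (intro smooth_sum smooth_mult smooth_const)
      (simp_all add: smooth_dpow poly_funs_smooth monval_poly_funs)
  then show ?thesis by simp
qed

lemma act_sum_right:
  assumes "\<And>a. a \<in> S \<Longrightarrow> smooth (f a)"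
  shows "act w (\<lambda>x. \<Sum>a\<in>S. f a x) x = (\<Sum>a\<in>S. act w (f a) x)"
proof -
  have "dpow \<beta> (\<lambda>x. \<Sum>a\<in>S. f a x) = (\<lambda>x. \<Sum>a\<in>S. dpow \<beta> (f a) x)" for \<beta>
    using dpow_sum[of S f \<beta> "\<lambda>_. 1"] assms by simp
  then show ?thesis
    unfolding act_def by (subst sum.swap) (simp add: sum_distrib_left)
qed

text \<open>The origin of the constants in \<open>weyl_mult\<close>: in the Leibniz rule, terms with
  \<open>\<kappa>\<close> not below \<open>\<gamma>\<close> differentiate the monomial to zero, and
  the others contribute a binomial and a falling factorial in each coordinate.\<close>

lemma dpow_monval_mult:
  assumes "smooth f"
  shows "dpow \<beta> (\<lambda>x. monval \<gamma> x * f x) x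
    = (\<Sum>\<kappa>\<in>{\<kappa>. \<forall>i. \<kappa> i \<le> \<beta> i \<and> \<kappa> i \<le> \<gamma> i}.
        (\<Prod>i\<in>UNIV. of_nat (\<beta> i choose \<kappa> i) * (of_nat (fact (\<gamma> i)) / of_nat (fact (\<gamma> i - \<kappa> i))))
        * (monval (\<lambda>i. \<gamma> i - \<kappa> i) x * dpow (\<lambda>i. \<beta> i - \<kappa> i) f x))"
    (is "_ = sum ?g ?S")
proof -
  have "dpow \<beta> (\<lambda>x. monval \<gamma> x * f x) x = (\<Sum>\<kappa>\<in>{\<kappa>. \<forall>i. \<kappa> i \<le> \<beta> i}. mbinom \<beta> \<kappa> *
      ((\<Prod>i\<in>UNIV. ffact (\<gamma> i) (\<kappa> i)) * monval (\<lambda>i. \<gamma> i - \<kappa> i) x * dpow (\<lambda>i. \<beta> i - \<kappa> i) f x))"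
    by (simp add: dpow_mult[OF poly_funs_smooth[OF monval_poly_funs] assms] dpow_monval)
  also have "\<dots> = sum ?g ?S"
  proof (rule sum.mono_neutral_cong_right[OF finite_multi_index_le])
    show "\<forall>\<kappa>\<in>{\<kappa>. \<forall>i. \<kappa> i \<le> \<beta> i} - ?S. mbinom \<beta> \<kappa> *
      ((\<Prod>i\<in>UNIV. ffact (\<gamma> i) (\<kappa> i)) * monval (\<lambda>i. \<gamma> i - \<kappa> i) x * dpow (\<lambda>i. \<beta> i - \<kappa> i) f x) = 0"
    proof
      fix \<kappa> assume "\<kappa> \<in> {\<kappa>. \<forall>i. \<kappa> i \<le> \<beta> i} - ?S"
      then obtain i where "\<not> \<kappa> i \<le> \<gamma> i" by blast
      then have "(\<Prod>i\<in>UNIV. ffact (\<gamma> i) (\<kappa> i)) = 0"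
        by (intro prod_zero) (auto intro!: exI[of _ i] ffact_eq_0)
      then show "mbinom \<beta> \<kappa> *
        ((\<Prod>i\<in>UNIV. ffact (\<gamma> i) (\<kappa> i)) * monval (\<lambda>i. \<gamma> i - \<kappa> i) x * dpow (\<lambda>i. \<beta> i - \<kappa> i) f x) = 0"
        by simp
    qed
  next
    fix \<kappa> assume "\<kappa> \<in> ?S"
    then have "(\<Prod>i\<in>UNIV. ffact (\<gamma> i) (\<kappa> i))
        = (\<Prod>i\<in>UNIV. of_nat (fact (\<gamma> i)) / of_nat (fact (\<gamma> i - \<kappa> i)))"
      by (intro prod.cong) (auto simp: ffact_eq)
    then show "mbinom \<beta> \<kappa> * ((\<Prod>i\<in>UNIV. ffact (\<gamma> i) (\<kappa> i)) * monval (\<lambda>i. \<gamma> i - \<kappa> i) x *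
        dpow (\<lambda>i. \<beta> i - \<kappa> i) f x) = ?g \<kappa>"
      unfolding prod.distrib mbinom_def by (simp only: mult.assoc)
  qed blast
  finally show ?thesis .
qed

text \<open>Flattens the triple sum of \<open>weyl_mult\<close> into one index set, so that the
  product becomes a formal sum in the sense of \<open>act_combination\<close>.\<close>

definition mult_index :: "'n::finite weyl \<Rightarrow> 'n weyl \<Rightarrow>
    ((('n \<Rightarrow> nat) \<times> ('n \<Rightarrow> nat)) \<times> (('n \<Rightarrow> nat) \<times> ('n \<Rightarrow> nat)) \<times> ('n \<Rightarrow> nat)) set" where
  "mult_index x y = (SIGMA u:{u. x u \<noteq> 0}. SIGMA v:{v. y v \<noteq> 0}.
     {\<kappa>. \<forall>i. \<kappa> i \<le> snd u i \<and> \<kappa> i \<le> fst v i})"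

lemma finite_le_both: "finite {\<kappa>::'n::finite \<Rightarrow> nat. \<forall>i. \<kappa> i \<le> \<beta> i \<and> \<kappa> i \<le> \<gamma> i}"
  by (rule finite_subset[OF _ finite_multi_index_le[of \<beta>]]) blast

lemma finite_mult_index: "is_weyl x \<Longrightarrow> is_weyl y \<Longrightarrow> finite (mult_index x y)"
  unfolding mult_index_def is_weyl_def by (intro finite_SigmaI finite_le_both)

lemma sum_mult_index:
  assumes "is_weyl x" "is_weyl y"
  shows "(\<Sum>u\<in>{u. x u \<noteq> 0}. \<Sum>v\<in>{v. y v \<noteq> 0}.
      \<Sum>\<kappa>\<in>{\<kappa>. \<forall>i. \<kappa> i \<le> snd u i \<and> \<kappa> i \<le> fst v i}. h u v \<kappa>)
    = (\<Sum>(u,v,\<kappa>)\<in>mult_index x y. h u v \<kappa>)"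
  using assms unfolding mult_index_def is_weyl_def
  by (simp add: sum.Sigma finite_le_both)

lemma weyl_mult_combination:
  fixes x y :: "'n::finite weyl"
  assumes "is_weyl x" "is_weyl y"
  shows "weyl_mult x y = (\<lambda>c. \<Sum>s\<in>mult_index x y.
     if c = (case s of (u,v,\<kappa>) \<Rightarrow> (\<lambda>i. fst u i + fst v i - \<kappa> i, \<lambda>i. snd u i - \<kappa> i + snd v i))
     then (case s of (u,v,\<kappa>) \<Rightarrow> x u * y v * (\<Prod>i\<in>UNIV. of_nat (snd u i choose \<kappa> i) *
                 (of_nat (fact (fst v i)) / of_nat (fact (fst v i - \<kappa> i)))))
     else 0)"
proof
  fix c :: "('n \<Rightarrow> nat) \<times> ('n \<Rightarrow> nat)"
  obtain a b where c: "c = (a, b)" by (cases c)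
  show "weyl_mult x y c = (\<Sum>s\<in>mult_index x y.
     if c = (case s of (u,v,\<kappa>) \<Rightarrow> (\<lambda>i. fst u i + fst v i - \<kappa> i, \<lambda>i. snd u i - \<kappa> i + snd v i))
     then (case s of (u,v,\<kappa>) \<Rightarrow> x u * y v * (\<Prod>i\<in>UNIV. of_nat (snd u i choose \<kappa> i) *
                 (of_nat (fact (fst v i)) / of_nat (fact (fst v i - \<kappa> i)))))
     else 0)"
    unfolding weyl_mult_def c prod.case sum_mult_index[OF assms]
    by (intro sum.cong refl) (simp add: split_def)
qed

lemma is_weyl_weyl_mult: "is_weyl x \<Longrightarrow> is_weyl y \<Longrightarrow> is_weyl (weyl_mult x y)"
  by (subst weyl_mult_combination) (auto intro!: is_weyl_combination finite_mult_index)

lemma act_weyl_mult: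
  fixes x y :: "'n::finite weyl"
  assumes x: "is_weyl x" and y: "is_weyl y" and f: "smooth f"
  shows "act (weyl_mult x y) f = act x (act y f)"
proof
  fix z
  let ?C = "\<lambda>(u::('n \<Rightarrow> nat) \<times> ('n \<Rightarrow> nat)) (v::('n \<Rightarrow> nat) \<times> ('n \<Rightarrow> nat)) \<kappa>. (\<Prod>i\<in>UNIV. of_nat (snd u i choose \<kappa> i) *
                 (of_nat (fact (fst v i)) / of_nat (fact (fst v i - \<kappa> i)))) :: complex"
  have y_eq: "act y f = (\<lambda>z. \<Sum>v\<in>{v. y v \<noteq> 0}. y v * (monval (fst v) z * dpow (snd v) f z))"
    by (rule ext) (simp add: act_def mult.assoc)
  have "act (weyl_mult x y) f z = (\<Sum>(u,v,\<kappa>)\<in>mult_index x y. x u * y v * ?C u v \<kappa>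
      * monval (\<lambda>i. fst u i + fst v i - \<kappa> i) z * dpow (\<lambda>i. snd u i - \<kappa> i + snd v i) f z)"
    unfolding weyl_mult_combination[OF x y] act_combination[OF finite_mult_index[OF x y]]
    by (rule sum.cong) auto
  also have "\<dots> = (\<Sum>u\<in>{u. x u \<noteq> 0}. \<Sum>v\<in>{v. y v \<noteq> 0}. \<Sum>\<kappa>\<in>{\<kappa>. \<forall>i. \<kappa> i \<le> snd u i \<and> \<kappa> i \<le> fst v i}.
      x u * y v * ?C u v \<kappa> * monval (\<lambda>i. fst u i + fst v i - \<kappa> i) z * dpow (\<lambda>i. snd u i - \<kappa> i + snd v i) f z)"
    by (rule sum_mult_index[OF x y, symmetric])
  also have "\<dots> = (\<Sum>u\<in>{u. x u \<noteq> 0}. x u * monval (fst u) z * dpow (snd u) (act y f) z)"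
  proof (rule sum.cong[OF refl])
    fix u :: "('n \<Rightarrow> nat) \<times> ('n \<Rightarrow> nat)"
    have "dpow (snd u) (act y f) z
        = (\<Sum>v\<in>{v. y v \<noteq> 0}. y v * dpow (snd u) (\<lambda>z. monval (fst v) z * dpow (snd v) f z) z)"
      unfolding y_eq
      by (subst dpow_sum) (simp_all add: smooth_mult smooth_dpow f poly_funs_smooth monval_poly_funs)
    also have "\<dots> = (\<Sum>v\<in>{v. y v \<noteq> 0}. \<Sum>\<kappa>\<in>{\<kappa>. \<forall>i. \<kappa> i \<le> snd u i \<and> \<kappa> i \<le> fst v i}.
        y v * ?C u v \<kappa> * monval (\<lambda>i. fst v i - \<kappa> i) z * dpow (\<lambda>i. snd u i - \<kappa> i + snd v i) f z)"
      by (simp only: dpow_monval_mult[OF smooth_dpow[OF f]] dpow_dpow[OF f] sum_distrib_left mult.assoc)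
    finally have eq: "dpow (snd u) (act y f) z = \<dots>" .
    \<comment> \<open>The bound \<open>\<kappa> i \<le> fst v i\<close> is what makes the truncated
      exponent split into two monomials.\<close>
    have mon: "monval (\<lambda>i. fst u i + fst v i - \<kappa> i) z = monval (fst u) z * monval (\<lambda>i. fst v i - \<kappa> i) z"
      if "\<kappa> \<in> {\<kappa>. \<forall>i. \<kappa> i \<le> snd u i \<and> \<kappa> i \<le> fst v i}" for v :: "('n \<Rightarrow> nat) \<times> ('n \<Rightarrow> nat)" and \<kappa>
      using that by (simp add: monval_add)
    show "(\<Sum>v\<in>{v. y v \<noteq> 0}. \<Sum>\<kappa>\<in>{\<kappa>. \<forall>i. \<kappa> i \<le> snd u i \<and> \<kappa> i \<le> fst v i}.
      x u * y v * ?C u v \<kappa> * monval (\<lambda>i. fst u i + fst v i - \<kappa> i) z * dpow (\<lambda>i. snd u i - \<kappa> i + snd v i) f z)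
      = x u * monval (fst u) z * dpow (snd u) (act y f) z"
      unfolding eq sum_distrib_left
      by (intro sum.cong refl) (simp only: mon mult_ac)
  qed
  finally show "act (weyl_mult x y) f z = act x (act y f) z" by (simp add: act_def)
qed

definition weyl_one :: "'n weyl" where
  "weyl_one = (\<lambda>c. if c = (\<lambda>_. 0, \<lambda>_. 0) then 1 else 0)"

lemma is_weyl_one: "is_weyl weyl_one"
  by (simp add: is_weyl_def weyl_one_def)

lemma weyl_mult_one:
  fixes y :: "'n::finite weyl"
  assumes "is_weyl y"
  shows "weyl_mult weyl_one y = y"
proof
  fix c :: "('n \<Rightarrow> nat) \<times> ('n \<Rightarrow> nat)"
  obtain a b where c: "c = (a, b)" by (cases c)
  have 1: "{u. weyl_one u \<noteq> 0} = {(\<lambda>_. 0, \<lambda>_. 0) :: ('n \<Rightarrow> nat) \<times> ('n \<Rightarrow> nat)}"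
    by (auto simp: weyl_one_def)
  have "weyl_mult weyl_one y c
      = (\<Sum>u\<in>{u :: ('n \<Rightarrow> nat) \<times> ('n \<Rightarrow> nat). weyl_one u \<noteq> 0}. \<Sum>v\<in>{v. y v \<noteq> 0}. if c = v then y v else 0)"
    unfolding weyl_mult_def c prod.case
  proof (intro sum.cong refl, goal_cases)
    case (1 u v)
    then have u: "u = (\<lambda>_. 0, \<lambda>_. 0)" by (simp add: weyl_one_def split: if_splits)
    have S: "{\<kappa>. \<forall>i. \<kappa> i \<le> snd u i \<and> \<kappa> i \<le> fst v i} = {\<lambda>_. 0}" by (auto simp: u)
    show ?case unfolding S by (simp add: u weyl_one_def prod_eq_iff)
  qed
  then show "weyl_mult weyl_one y c = y c"
    using assms by (simp add: 1 is_weyl_def)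
qed

lemma weyl_mult_zero_left: "weyl_mult (\<lambda>_. 0) y = (\<lambda>_. 0)"
  by (auto simp: weyl_mult_def)

subsection \<open>Shift automorphisms\<close>

text \<open>The definition reads the target exponent off the argument; summing over all targets
  instead exhibits \<open>sigma lam w\<close> as a formal sum.\<close>

lemma sigma_combination:
  fixes w :: "'n::finite weyl"
  assumes "is_weyl w"
  shows "sigma lam w = (\<lambda>c. \<Sum>s\<in>(SIGMA u:{u. w u \<noteq> 0}. {b. \<forall>i. b i \<le> snd u i}).
    if c = (fst (fst s), snd s)
    then w (fst s) * (\<Prod>i\<in>UNIV. of_nat (snd (fst s) i choose snd s i) * (- lam i) ^ (snd (fst s) i - snd s i))
    else 0)" (is "_ = ?r")
proof
  fix c :: "('n \<Rightarrow> nat) \<times> ('n \<Rightarrow> nat)"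
  obtain a b where c: "c = (a, b)" by (cases c)
  have "sigma lam w c = (\<Sum>u\<in>{u. w u \<noteq> 0}. \<Sum>b'\<in>{b. \<forall>i. b i \<le> snd u i}. if c = (fst u, b')
      then w u * (\<Prod>i\<in>UNIV. of_nat (snd u i choose b' i) * (- lam i) ^ (snd u i - b' i)) else 0)"
    unfolding sigma_def c prod.case
  proof (rule sum.cong[OF refl])
    fix u :: "('n \<Rightarrow> nat) \<times> ('n \<Rightarrow> nat)"
    show "(if fst u = a \<and> (\<forall>i. b i \<le> snd u i)
        then w u * (\<Prod>i\<in>UNIV. of_nat (snd u i choose b i) * (- lam i) ^ (snd u i - b i)) else 0)
      = (\<Sum>b'\<in>{b. \<forall>i. b i \<le> snd u i}. if (a, b) = (fst u, b')
        then w u * (\<Prod>i\<in>UNIV. of_nat (snd u i choose b' i) * (- lam i) ^ (snd u i - b' i)) else 0)"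
      by (cases "fst u = a") (simp_all add: sum.delta' finite_multi_index_le)
  qed
  also have "\<dots> = ?r c"
    using assms by (simp add: sum.Sigma is_weyl_def finite_multi_index_le split_def)
  finally show "sigma lam w c = ?r c" .
qed

lemma finite_sigma_index:
  fixes w :: "'n::finite weyl"
  shows "is_weyl w \<Longrightarrow> finite (SIGMA u:{u. w u \<noteq> 0}. {b. \<forall>i. b i \<le> snd u i})"
  unfolding is_weyl_def by (intro finite_SigmaI finite_multi_index_le)

lemma is_weyl_sigma: "is_weyl w \<Longrightarrow> is_weyl (sigma lam w)"
  by (subst sigma_combination) (auto intro!: is_weyl_combination finite_sigma_index)

text \<open>Past the exponential, each derivative \<open>\<partial>_i\<close> becomes
  \<open>\<partial>_i + lam i\<close>, by the Leibniz rule. As \<open>sigma\<close> subtracts its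
  parameter, the shift is taken with \<open>- lam\<close>.\<close>

lemma act_mult_exp_fun:
  assumes w: "is_weyl w" and f: "smooth f"
  shows "act w (\<lambda>x. f x * exp_fun lam x) x = act (sigma (\<lambda>i. - lam i) w) f x * exp_fun lam x"
proof -
  have "act (sigma (\<lambda>i. - lam i) w) f x = (\<Sum>u\<in>{u. w u \<noteq> 0}. \<Sum>b\<in>{b. \<forall>i. b i \<le> snd u i}.
      w u * (\<Prod>i\<in>UNIV. of_nat (snd u i choose b i) * lam i ^ (snd u i - b i)) * monval (fst u) x * dpow b f x)"
    unfolding sigma_combination[OF w] act_combination[OF finite_sigma_index[OF w]]
    using w by (simp add: sum.Sigma is_weyl_def finite_multi_index_le split_def)
  also have "\<dots> * exp_fun lam x = (\<Sum>u\<in>{u. w u \<noteq> 0}. w u * monval (fst u) x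
      * dpow (snd u) (\<lambda>x. f x * exp_fun lam x) x)"
    unfolding dpow_mult[OF f smooth_exp_fun] dpow_exp_fun sum_distrib_left sum_distrib_right
    by (intro sum.cong refl) (simp add: mbinom_def prod.distrib mult_ac)
  finally show ?thesis by (simp add: act_def)
qed

text \<open>Compares the coefficients of \<open>d ^ b\<close> in
  \<open>((d - z) + z) ^ n = d ^ n\<close>. Choosing the \<open>b\<close>-subset first turns the sum
  into a multiple of \<open>(- z + z) ^ (n - b)\<close>, which is nonzero only for
  \<open>n = b\<close>.\<close>

lemma sum_binomial_inversion:
  fixes z :: complex
  shows "(\<Sum>k\<le>n. of_nat (n choose k) * z ^ (n - k) * (of_nat (k choose b) * (- z) ^ (k - b)))
    = (if n = b then 1 else 0)"
proof (cases "b \<le> n")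
  case False
  then show ?thesis by (auto intro!: sum.neutral)
next
  case True
  have "(\<Sum>k\<le>n. of_nat (n choose k) * z ^ (n - k) * (of_nat (k choose b) * (- z) ^ (k - b)))
      = (\<Sum>k\<in>{b..n}. of_nat (n choose k) * z ^ (n - k) * (of_nat (k choose b) * (- z) ^ (k - b)))"
    by (rule sum.mono_neutral_right) auto
  also have "\<dots> = (\<Sum>k\<le>n - b. of_nat (n choose b) * (of_nat (n - b choose k) * (- z) ^ k * z ^ (n - b - k)))"
  proof (rule sum.reindex_bij_witness[where i = "\<lambda>k. k + b" and j = "\<lambda>k. k - b"])
    fix k assume k: "k \<in> {b..n}"
    then have "(n choose k) * (k choose b) = (n choose b) * (n - b choose (k - b))"
      by (simp add: choose_mult)
    then have "of_nat (n choose k) * of_nat (k choose b)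
        = (of_nat (n choose b) * of_nat (n - b choose (k - b)) :: complex)"
      by (metis of_nat_mult)
    then show "of_nat (n choose b) * (of_nat (n - b choose (k - b)) * (- z) ^ (k - b) * z ^ (n - b - (k - b)))
        = of_nat (n choose k) * z ^ (n - k) * (of_nat (k choose b) * (- z) ^ (k - b))"
      using k by (simp add: mult_ac)
  qed (use True in auto)
  also have "\<dots> = of_nat (n choose b) * (- z + z) ^ (n - b)"
    by (simp only: sum_distrib_left[symmetric] binomial_ring)
  finally show ?thesis using True by (simp add: power_0_left)
qed

text \<open>Opposite shifts cancel. Over a box of multi-indices the sum of products is a product of
  sums, so each coordinate is settled by \<open>sum_binomial_inversion\<close>.\<close>

lemma sigma_sigma_uminus:
  fixes w :: "'n::finite weyl"
  assumes w: "is_weyl w"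
  shows "sigma lam (sigma (\<lambda>i. - lam i) w) = w"
proof
  fix c :: "('n \<Rightarrow> nat) \<times> ('n \<Rightarrow> nat)"
  obtain a b where c: "c = (a, b)" by (cases c)
  let ?w = "sigma (\<lambda>i. - lam i) w"
  let ?S = "SIGMA u:{u. w u \<noteq> 0}. {b. \<forall>i. b i \<le> snd u i}"
  let ?g = "\<lambda>s. (fst (fst s), snd s) :: ('n \<Rightarrow> nat) \<times> ('n \<Rightarrow> nat)"
  define h where "h = (\<lambda>u::('n \<Rightarrow> nat) \<times> ('n \<Rightarrow> nat). if fst u = a \<and> (\<forall>i. b i \<le> snd u i)
      then (\<Prod>i\<in>UNIV. of_nat (snd u i choose b i) * (- lam i) ^ (snd u i - b i)) else 0)"
  have h: "h u = (if fst u = a then (\<Prod>i\<in>UNIV. of_nat (snd u i choose b i) * (- lam i) ^ (snd u i - b i)) else 0)"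
    for u
  proof -
    have "(\<Prod>i\<in>UNIV. of_nat (snd u i choose b i) * (- lam i) ^ (snd u i - b i)) = 0" if "\<not> b i \<le> snd u i" for i
      by (rule prod_zero) (use that in \<open>auto simp: not_le intro: exI[of _ i]\<close>)
    then show ?thesis unfolding h_def by auto
  qed
  have "sigma lam ?w c = (\<Sum>u\<in>{u. ?w u \<noteq> 0}. ?w u * h u)"
    unfolding sigma_def[of lam] c prod.case h_def by (intro sum.cong) auto
  also have "\<dots> = (\<Sum>u\<in>?g ` ?S. ?w u * h u)"
  proof (rule sum.mono_neutral_left)
    show "finite (?g ` ?S)" by (intro finite_imageI finite_sigma_index w)
    show "{u. ?w u \<noteq> 0} \<subseteq> ?g ` ?S"
      unfolding sigma_combination[OF w] by (rule combination_support)
  qed auto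
  also have "\<dots> = (\<Sum>s\<in>?S. w (fst s) * (\<Prod>i\<in>UNIV. of_nat (snd (fst s) i choose snd s i)
       * lam i ^ (snd (fst s) i - snd s i)) * h (?g s))"
    unfolding sigma_combination[OF w] sum_single_swap[OF finite_sigma_index[OF w]] by simp
  also have "\<dots> = (\<Sum>u\<in>{u. w u \<noteq> 0}. \<Sum>b'\<in>{b. \<forall>i. b i \<le> snd u i}. w u *
      (\<Prod>i\<in>UNIV. of_nat (snd u i choose b' i) * lam i ^ (snd u i - b' i)) * h (fst u, b'))"
    using w by (simp add: sum.Sigma is_weyl_def finite_multi_index_le split_def)
  also have "\<dots> = (\<Sum>u\<in>{u. w u \<noteq> 0}. if c = u then w u else 0)"
  proof (rule sum.cong[OF refl])
    fix u :: "('n \<Rightarrow> nat) \<times> ('n \<Rightarrow> nat)"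
    have PiE: "{b. \<forall>i. b i \<le> snd u i} = PiE UNIV (\<lambda>i. {..snd u i})"
      by (auto simp: PiE_def Pi_def)
    have "(\<Sum>b'\<in>{b. \<forall>i. b i \<le> snd u i}. (\<Prod>i\<in>UNIV. of_nat (snd u i choose b' i) * lam i ^ (snd u i - b' i)
        * (of_nat (b' i choose b i) * (- lam i) ^ (b' i - b i))))
      = (\<Prod>i\<in>UNIV. \<Sum>k\<le>snd u i. of_nat (snd u i choose k) * lam i ^ (snd u i - k)
        * (of_nat (k choose b i) * (- lam i) ^ (k - b i)))"
      unfolding PiE by (subst prod_sum_PiE) auto
    also have "\<dots> = (if snd u = b then 1 else 0)"
      unfolding sum_binomial_inversion by (auto simp: fun_eq_iff)
    finally have "(\<Sum>b'\<in>{b. \<forall>i. b i \<le> snd u i}. (\<Prod>i\<in>UNIV. of_nat (snd u i choose b' i) * lam i ^ (snd u i - b' i))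
        * (\<Prod>i\<in>UNIV. of_nat (b' i choose b i) * (- lam i) ^ (b' i - b i))) = (if snd u = b then 1 else 0)"
      by (simp add: prod.distrib)
    then show "(\<Sum>b'\<in>{b. \<forall>i. b i \<le> snd u i}. w u *
      (\<Prod>i\<in>UNIV. of_nat (snd u i choose b' i) * lam i ^ (snd u i - b' i)) * h (fst u, b'))
      = (if c = u then w u else 0)"
      by (cases "fst u = a") (auto simp: h c prod_eq_iff mult.assoc sum_distrib_left[symmetric])
  qed
  also have "\<dots> = w c" using w by (simp add: is_weyl_def)
  finally show "sigma lam ?w c = w c" .
qed

subsection \<open>Independence of exponentials\<close>

text \<open>The operator \<open>d/ds - \<nu>\<close> lowers the degree of the coefficient of \<open>exp (\<nu> s)\<close> and preserves the
  degrees of all other coefficients, so the total degree can serve for induction.\<close>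

lemma exp_poly_independent:
  fixes q :: "complex \<Rightarrow> complex poly"
  assumes "finite C"
    and "\<And>s::real. (\<Sum>c\<in>C. poly (q c) (of_real s) * exp (c * of_real s)) = 0"
  shows "\<forall>c\<in>C. q c = 0"
  using assms(2)
proof (induction "\<Sum>c\<in>C. length (coeffs (q c))" arbitrary: q rule: less_induct)
  case less
  show ?case
  proof (rule ccontr)
    assume "\<not> (\<forall>c\<in>C. q c = 0)"
    then obtain \<nu> where \<nu>: "\<nu> \<in> C" "q \<nu> \<noteq> 0" by blast
    define q' where "q' = (\<lambda>c. pderiv (q c) + smult (c - \<nu>) (q c))"
    have deriv: "(\<Sum>c\<in>C. (poly (pderiv (q c)) (of_real s) + c * poly (q c) (of_real s)) * exp (c * of_real s)) = 0"
      for s :: real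
    proof -
      have "((\<lambda>z. \<Sum>c\<in>C. poly (q c) z * exp (c * z)) has_field_derivative
          (\<Sum>c\<in>C. (poly (pderiv (q c)) (of_real s) + c * poly (q c) (of_real s)) * exp (c * of_real s)))
          (at (of_real s))"
        by (rule DERIV_sum) (auto intro!: derivative_eq_intros poly_DERIV simp: algebra_simps)
      from has_vector_derivative_real_field[OF this]
      have "((\<lambda>s::real. 0) has_vector_derivative
          (\<Sum>c\<in>C. (poly (pderiv (q c)) (of_real s) + c * poly (q c) (of_real s)) * exp (c * of_real s))) (at s)"
        by (simp only: less.prems)
      from vector_derivative_unique_at[OF this has_vector_derivative_const] show ?thesis .
    qed
    have zero': "(\<Sum>c\<in>C. poly (q' c) (of_real s) * exp (c * of_real s)) = 0" for s :: real
    proof -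
      have "(\<Sum>c\<in>C. poly (q' c) (of_real s) * exp (c * of_real s))
        = (\<Sum>c\<in>C. (poly (pderiv (q c)) (of_real s) + c * poly (q c) (of_real s)) * exp (c * of_real s))
          - \<nu> * (\<Sum>c\<in>C. poly (q c) (of_real s) * exp (c * of_real s))"
        by (simp add: q'_def sum_distrib_left sum_subtractf[symmetric] algebra_simps)
      then show ?thesis by (simp only: deriv less.prems) simp
    qed
    have le: "length (coeffs (q' c)) \<le> length (coeffs (q c))" for c
    proof (cases "q' c = 0 \<or> q c = 0")
      case False
      have "degree (q' c) \<le> degree (q c)"
        unfolding q'_def by (intro degree_add_le) (auto simp: degree_pderiv)
      with False show ?thesis by (simp add: length_coeffs_degree)
    qed (auto simp: q'_def)
    \<comment> \<open>Here \<open>q' \<nu>\<close> is just the derivative. Unlike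
      \<open>degree\<close>, the number of coefficients also drops when a nonzero constant becomes
      0.\<close>
    have less': "length (coeffs (q' \<nu>)) < length (coeffs (q \<nu>))"
    proof (cases "pderiv (q \<nu>) = 0")
      case False
      then have "degree (q \<nu>) \<noteq> 0" by (simp add: pderiv_eq_0_iff)
      with False \<nu> show ?thesis by (simp add: q'_def length_coeffs_degree degree_pderiv)
    qed (use \<nu> in \<open>simp add: q'_def\<close>)
    have "(\<Sum>c\<in>C. length (coeffs (q' c))) < (\<Sum>c\<in>C. length (coeffs (q c)))"
      by (rule sum_strict_mono_ex1) (use \<open>finite C\<close> le less' \<nu> in auto)
    from less.hyps[OF this zero'] have q'0: "q' c = 0" if "c \<in> C" for c using that by blast
    \<comment> \<open>Differentiation has no nonzero polynomial eigenvector with eigenvalue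
      \<open>\<nu> - c \<noteq> 0\<close>: the degree would have to stay the same.\<close>
    have "q c = 0" if "c \<in> C - {\<nu>}" for c
    proof (rule ccontr)
      assume "q c \<noteq> 0"
      have eq: "pderiv (q c) = smult (\<nu> - c) (q c)"
        using q'0[of c] that by (simp add: q'_def eq_neg_iff_add_eq_0[symmetric] smult_diff_left)
      then have "degree (q c) - 1 = degree (q c)"
        using that degree_pderiv[of "q c"] by (simp split: if_splits)
      then have "pderiv (q c) = 0" by (simp add: pderiv_eq_0_iff)
      with eq \<open>q c \<noteq> 0\<close> that show False by simp
    qed
    \<comment> \<open>Only the \<open>\<nu>\<close> term survives, and it has derivative 0, so its
      value at 0 determines it.\<close>
    then have "poly (q \<nu>) 0 = 0"
      using less.prems[of 0] \<nu>(1) \<open>finite C\<close> by (simp add: sum.remove[of C \<nu>])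
    moreover have "pderiv (q \<nu>) = 0" using q'0[OF \<nu>(1)] by (simp add: q'_def)
    then have "degree (q \<nu>) = 0" by (simp add: pderiv_eq_0_iff)
    then obtain z where "q \<nu> = [:z:]" by (rule degree_eq_zeroE)
    ultimately have "q \<nu> = 0" by simp
    with \<nu>(2) show False ..
  qed
qed

lemma exp_fun_neq_0: "exp_fun lam x \<noteq> 0"
  by (simp add: exp_fun_def)

text \<open>Restricting to lines in one coordinate direction at a time reduces to a single variable
  without having to choose a direction that separates the exponents.\<close>

lemma exp_fun_independent_on_coordinates:
  fixes \<mu> :: "'i \<Rightarrow> 'n::finite \<Rightarrow> complex"
  assumes "finite I" and P: "\<And>i. i \<in> I \<Longrightarrow> P i \<in> poly_funs"
    and zero: "\<And>x. (\<Sum>i\<in>I. P i x * exp_fun (\<mu> i) x) = 0"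
    and "finite J"
  shows "(\<Sum>i\<in>{i\<in>I. \<forall>j\<in>J. \<mu> i j = \<nu> j}. P i x * exp_fun (\<mu> i) x) = 0"
  using \<open>finite J\<close>
proof (induction J arbitrary: x rule: finite_induct)
  case empty
  then show ?case using zero by simp
next
  case (insert k J)
  define I' where "I' = {i\<in>I. \<forall>j\<in>J. \<mu> i j = \<nu> j}"
  have fin: "finite I'" using \<open>finite I\<close> by (simp add: I'_def)
  have "\<forall>i\<in>I'. \<exists>q. \<forall>s::real. P i (x + s *\<^sub>R axis k 1) = poly q (of_real s)"
    using poly_funs_along_line[OF P] by (auto simp: I'_def)
  then obtain q where q: "\<And>i s. i \<in> I' \<Longrightarrow> P i (x + s *\<^sub>R axis k 1) = poly (q i) (complex_of_real s)"
    by metis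
  \<comment> \<open>Several indices may share the frequency \<open>c\<close> in direction
    \<open>k\<close>. Their coefficients are pooled, weighted by the values of the exponentials at
    the base point, so that the frequencies on the line become distinct.\<close>
  define Q where "Q = (\<lambda>c. \<Sum>i\<in>{i\<in>I'. \<mu> i k = c}. smult (exp_fun (\<mu> i) x) (q i))"
  have "(\<Sum>c\<in>(\<lambda>i. \<mu> i k) ` I'. poly (Q c) (of_real s) * exp (c * of_real s)) = 0" for s :: real
  proof -
    have "(\<Sum>c\<in>(\<lambda>i. \<mu> i k) ` I'. poly (Q c) (of_real s) * exp (c * of_real s))
        = (\<Sum>c\<in>(\<lambda>i. \<mu> i k) ` I'. \<Sum>i\<in>{i\<in>I'. \<mu> i k = c}.
            P i (x + s *\<^sub>R axis k 1) * exp_fun (\<mu> i) (x + s *\<^sub>R axis k 1))"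
      unfolding Q_def poly_sum sum_distrib_right
      by (intro sum.cong refl) (auto simp: q exp_fun_along_axis mult_ac)
    also have "\<dots> = (\<Sum>i\<in>I'. P i (x + s *\<^sub>R axis k 1) * exp_fun (\<mu> i) (x + s *\<^sub>R axis k 1))"
      by (rule sum.image_gen[OF fin, symmetric])
    also have "\<dots> = 0" unfolding I'_def by (rule insert.IH)
    finally show ?thesis .
  qed
  from exp_poly_independent[OF finite_imageI[OF fin] this]
  have Q0: "Q (\<nu> k) = 0" if "\<nu> k \<in> (\<lambda>i. \<mu> i k) ` I'" using that by blast
  have set_eq: "{i\<in>I. \<forall>j\<in>insert k J. \<mu> i j = \<nu> j} = {i\<in>I'. \<mu> i k = \<nu> k}"
    by (auto simp: I'_def)
  show ?case
  proof (cases "\<nu> k \<in> (\<lambda>i. \<mu> i k) ` I'")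
    case True
    \<comment> \<open>At \<open>s = 0\<close> the pooled polynomial is exactly the partial sum
      sought at \<open>x\<close>.\<close>
    have "(\<Sum>i\<in>{i\<in>I'. \<mu> i k = \<nu> k}. P i x * exp_fun (\<mu> i) x) = poly (Q (\<nu> k)) 0"
      unfolding Q_def poly_sum using q[of _ 0] by (intro sum.cong refl) (simp add: mult.commute)
    then show ?thesis unfolding set_eq by (simp add: Q0[OF True])
  next
    case False
    then have "{i\<in>I'. \<mu> i k = \<nu> k} = {}" by force
    then show ?thesis unfolding set_eq by (simp only: sum.empty)
  qed
qed

lemma exp_fun_independent:
  fixes \<mu> :: "'i \<Rightarrow> 'n::finite \<Rightarrow> complex"
  assumes "finite I" "inj_on \<mu> I" "\<And>i. i \<in> I \<Longrightarrow> P i \<in> poly_funs"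
    and "\<And>x. (\<Sum>i\<in>I. P i x * exp_fun (\<mu> i) x) = 0" and "i \<in> I"
  shows "P i x = 0"
proof -
  have "{i'\<in>I. \<forall>j\<in>UNIV. \<mu> i' j = \<mu> i j} = {i}"
    using assms(2,5) by (auto simp: inj_on_def fun_eq_iff)
  with exp_fun_independent_on_coordinates[where J = UNIV and I = I and P = P and \<mu> = \<mu> and \<nu> = "\<mu> i" and x = x] assms
  have "P i x * exp_fun (\<mu> i) x = 0" by simp
  then show ?thesis by (simp add: exp_fun_neq_0)
qed

subsection \<open>Kernel decomposition and VMPUM\<close>

text \<open>A class is determined by any of its members, and every index below \<open>m\<close> has
  one; disjointness and covering both follow from this form.\<close>

lemma Kclasses_mem_iff: "K \<in> Kclasses m lam \<and> k \<in> K \<longleftrightarrow> k < m \<and> K = {k'. k' < m \<and> lam k' = lam k}"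
  by (auto simp: Kclasses_def)

lemma finite_Kclass: "K \<in> Kclasses m lam \<Longrightarrow> finite K"
  by (auto simp: Kclasses_def)

lemma Kclass_Min_mem: "K \<in> Kclasses m lam \<Longrightarrow> Min K \<in> K"
  by (rule Min_in) (auto simp: Kclasses_def)

lemma lam_Min_Kclass: "K \<in> Kclasses m lam \<Longrightarrow> k \<in> K \<Longrightarrow> lam (Min K) = lam k"
  using Kclass_Min_mem[of K m lam] by (auto simp: Kclasses_def)

lemma finite_Kclasses: "finite (Kclasses m lam)"
  by (simp add: Kclasses_def)

text \<open>Provides the distinct exponents for \<open>exp_fun_independent\<close>, with
  \<open>Min K\<close> as the representative of \<open>K\<close>.\<close>

lemma inj_on_lam_Min: "inj_on (\<lambda>K. lam (Min K)) (Kclasses m lam)"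
proof (rule inj_onI)
  fix K L assume K: "K \<in> Kclasses m lam" and L: "L \<in> Kclasses m lam" and eq: "lam (Min K) = lam (Min L)"
  have "K = {k'. k' < m \<and> lam k' = lam (Min K)}" "L = {k'. k' < m \<and> lam k' = lam (Min L)}"
    using Kclasses_mem_iff[of K m lam "Min K"] Kclasses_mem_iff[of L m lam "Min L"] K L
    by (simp_all add: Kclass_Min_mem)
  with eq show "K = L" by simp
qed

lemma sum_Kclasses: "(\<Sum>k<m. f k) = (\<Sum>K\<in>Kclasses m lam. \<Sum>k\<in>K. f k)"
proof -
  have "{..<m} = \<Union> (Kclasses m lam)" by (auto simp: Kclasses_def)
  moreover have "(\<Sum>k\<in>\<Union> (Kclasses m lam). f k) = (\<Sum>K\<in>Kclasses m lam. \<Sum>k\<in>K. f k)"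
    by (subst sum.Union_disjoint) (auto simp: Kclasses_def)
  ultimately show ?thesis by simp
qed

text \<open>Classes are disjoint, so at a given position only one summand can contribute. This
  yields the components of a sum and also its directness.\<close>

lemma sum_Kclasses_supported:
  fixes x :: "nat set \<Rightarrow> nat \<Rightarrow> 'c \<Rightarrow> complex"
  assumes "\<And>K k. K \<in> Kclasses m lam \<Longrightarrow> k \<notin> K \<Longrightarrow> x K k = (\<lambda>_. 0)" and L: "L \<in> Kclasses m lam" "k \<in> L"
  shows "(\<Sum>K\<in>Kclasses m lam. x K k c) = x L k c"
proof -
  have "(\<Sum>K\<in>Kclasses m lam. x K k c) = (\<Sum>K\<in>{L}. x K k c)"
  proof (rule sum.mono_neutral_right)
    show "\<forall>K\<in>Kclasses m lam - {L}. x K k c = 0"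
    proof
      fix K assume K: "K \<in> Kclasses m lam - {L}"
      then have "k \<notin> K" using Kclasses_mem_iff[of K m lam k] Kclasses_mem_iff[of L m lam k] L by auto
      with K show "x K k c = 0" by (simp add: assms(1))
    qed
  qed (use L finite_Kclasses in auto)
  then show ?thesis by simp
qed

lemma phi_nth:
  assumes "finite K" "j < card K"
  shows "phi K a (sorted_list_of_set K ! j) = a j"
proof
  fix c
  have "phi K a (sorted_list_of_set K ! j) c = (\<Sum>j'<card K. if j' = j then a j' c else 0)"
    unfolding phi_def
    by (intro sum.cong refl if_cong nth_eq_iff_index_eq) (use assms in auto)
  then show "phi K a (sorted_list_of_set K ! j) c = a j c" using assms by simp
qed

lemma phi_notin:
  assumes "finite K" "k \<notin> K"
  shows "phi K a k = (\<lambda>_. 0)"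
proof -
  have "sorted_list_of_set K ! j \<noteq> k" if "j < card K" for j
    using nth_mem[of j "sorted_list_of_set K"] assms that by auto
  then show ?thesis by (auto simp: phi_def)
qed

lemma bij_betw_sorted_list:
  "finite K \<Longrightarrow> bij_betw (\<lambda>j. sorted_list_of_set K ! j) {..<card K} K"
  by (rule bij_betw_nth) auto

text \<open>Removes the reindexing by \<open>sorted_list_of_set\<close> and the shift by
  \<open>sigma\<close> once and for all: each summand consists of the rows supported on
  \<open>K\<close> that annihilate the corresponding part of the signal.\<close>

lemma phi_Hset:
  fixes p :: "nat \<Rightarrow> 'n::finite cpoly"
  assumes K: "K \<in> Kclasses m lam"
  shows "phi K ` Hset p lam K = {a. (\<forall>k. k \<notin> K \<longrightarrow> a k = (\<lambda>_. 0)) \<and> (\<forall>k\<in>K. is_weyl (a k)) \<and>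
    (\<forall>x. (\<Sum>k\<in>K. act (a k) (\<lambda>x. poly_fun (p k) x * exp_fun (lam k) x) x) = 0)}"
    (is "?L = ?R")
proof -
  let ?\<mu> = "lam (Min K)"
  let ?s = "\<lambda>j. sorted_list_of_set K ! j"
  have fin: "finite K" using K by (rule finite_Kclass)
  have bij: "bij_betw ?s {..<card K} K" using fin by (rule bij_betw_sorted_list)
  have s_mem: "?s j \<in> K" if "j < card K" for j using bij that by (auto simp: bij_betw_def)
  have lam_s: "lam (?s j) = ?\<mu>" if "j < card K" for j
    using lam_Min_Kclass[OF K s_mem[OF that]] by simp
  \<comment> \<open>Within a class the exponential is a common factor. It never vanishes, so the
    class part is zero exactly when its polynomial factor is.\<close>
  have transfer: "(\<Sum>k\<in>K. act (a k) (\<lambda>x. poly_fun (p k) x * exp_fun (lam k) x) x)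
      = (\<Sum>j<card K. act (sigma (\<lambda>i. - ?\<mu> i) (a (?s j))) (hvec p K j) x) * exp_fun ?\<mu> x"
    if "\<forall>k\<in>K. is_weyl (a k)" for a x
  proof -
    have "(\<Sum>k\<in>K. act (a k) (\<lambda>x. poly_fun (p k) x * exp_fun (lam k) x) x)
       = (\<Sum>j<card K. act (a (?s j)) (\<lambda>x. poly_fun (p (?s j)) x * exp_fun (lam (?s j)) x) x)"
      by (rule sum.reindex_bij_betw[OF bij, symmetric])
    also have "\<dots> = (\<Sum>j<card K. act (sigma (\<lambda>i. - ?\<mu> i) (a (?s j))) (hvec p K j) x * exp_fun ?\<mu> x)"
      by (intro sum.cong refl)
        (simp add: lam_s s_mem that hvec_def act_mult_exp_fun poly_funs_smooth poly_fun_poly_funs)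
    finally show ?thesis by (simp add: sum_distrib_right)
  qed
  show ?thesis
  proof (intro equalityI subsetI)
    fix a assume "a \<in> ?L"
    then obtain b where b: "b \<in> kerset (card K) (hvec p K)" and a: "a = phi K (sigma_row ?\<mu> b)"
      by (auto simp: Hset_def)
    have wb: "is_weyl (b j)" if "j < card K" for j
      using b that by (simp add: kerset_def row_space_def)
    have a_s: "a (?s j) = sigma ?\<mu> (b j)" if "j < card K" for j
      using that fin by (simp add: a phi_nth sigma_row_def)
    have wa: "\<forall>k\<in>K. is_weyl (a k)"
    proof
      fix k assume "k \<in> K"
      then obtain j where "j < card K" "k = ?s j" using bij_betw_imp_surj_on[OF bij] by blast
      then show "is_weyl (a k)" by (simp add: a_s wb is_weyl_sigma)
    qed
    have "sigma (\<lambda>i. - ?\<mu> i) (a (?s j)) = b j" if "j < card K" for j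
      using sigma_sigma_uminus[OF wb[OF that], of "\<lambda>i. - ?\<mu> i"] by (simp add: a_s that)
    then have "(\<Sum>j<card K. act (sigma (\<lambda>i. - ?\<mu> i) (a (?s j))) (hvec p K j) x) = 0" for x
      using b by (simp add: kerset_def) meson
    then have "(\<Sum>k\<in>K. act (a k) (\<lambda>x. poly_fun (p k) x * exp_fun (lam k) x) x) = 0" for x
      unfolding transfer[OF wa] by simp
    with wa show "a \<in> ?R" using fin by (simp add: a phi_notin)
  next
    fix a assume a: "a \<in> ?R"
    \<comment> \<open>The preimage of \<open>a\<close>: entries are collected in increasing order of
      index and shifted back, with zero padding as \<open>row_space\<close> demands.\<close>
    define b where "b = (\<lambda>j. if j < card K then sigma (\<lambda>i. - ?\<mu> i) (a (?s j)) else (\<lambda>_. 0))"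
    have "(\<Sum>j<card K. act (b j) (hvec p K j) x) = 0" for x
      using a transfer[of a x] by (simp add: b_def exp_fun_neq_0)
    moreover have "b \<in> row_space (card K)"
      using a by (auto simp: row_space_def b_def s_mem is_weyl_sigma)
    ultimately have "b \<in> kerset (card K) (hvec p K)" by (simp add: kerset_def)
    moreover have "a = phi K (sigma_row ?\<mu> b)"
    proof
      fix k
      show "a k = phi K (sigma_row ?\<mu> b) k"
      proof (cases "k \<in> K")
        case True
        then obtain j where j: "j < card K" "k = ?s j"
          using bij_betw_imp_surj_on[OF bij] by blast
        then show ?thesis
          using a s_mem[of j] fin
          by (simp add: phi_nth sigma_row_def b_def sigma_sigma_uminus)
      next
        case False
        with a fin show ?thesis by (simp add: phi_notin)
      qed
    qed
    ultimately show "a \<in> ?L" by (auto simp: Hset_def)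
  qed
qed

lemma kerset_epvec:
  fixes p :: "nat \<Rightarrow> 'n::finite cpoly"
  shows "kerset m (epvec m p lam) = vsum_sets (Kclasses m lam) (\<lambda>K. phi K ` Hset p lam K)"
    (is "?L = ?R")
proof (intro equalityI subsetI)
  let ?f = "\<lambda>a k x. act (a k) (\<lambda>x. poly_fun (p k) x * exp_fun (lam k) x) x"
  fix a assume a: "a \<in> ?L"
  then have w: "is_weyl (a k)" if "k < m" for k using that by (simp add: kerset_def row_space_def)
  \<comment> \<open>The polynomial coefficient of the exponential belonging to \<open>K\<close>, to
    which independence is applied.\<close>
  define P where "P = (\<lambda>K x. \<Sum>k\<in>K. act (sigma (\<lambda>i. - lam (Min K) i) (a k)) (poly_fun (p k)) x)"
  have P: "(\<Sum>k\<in>K. ?f a k x) = P K x * exp_fun (lam (Min K)) x" if K: "K \<in> Kclasses m lam" for K x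
    unfolding P_def sum_distrib_right
  proof (rule sum.cong[OF refl])
    fix k assume "k \<in> K"
    with K have "k < m" "lam k = lam (Min K)"
      using Kclasses_mem_iff[of K m lam k] lam_Min_Kclass[OF K] by auto
    then show "?f a k x = act (sigma (\<lambda>i. - lam (Min K) i) (a k)) (poly_fun (p k)) x * exp_fun (lam (Min K)) x"
      by (simp add: act_mult_exp_fun w poly_funs_smooth poly_fun_poly_funs)
  qed
  have "(\<Sum>k<m. ?f a k x) = 0" for x
    using a by (simp add: kerset_def epvec_def fun_eq_iff)
  then have "(\<Sum>K\<in>Kclasses m lam. P K x * exp_fun (lam (Min K)) x) = 0" for x
    by (simp add: sum_Kclasses[of _ m lam] P)
  moreover have "P K \<in> poly_funs" for K
    unfolding P_def by (intro poly_funs_sum) (simp add: poly_funs_act poly_fun_poly_funs)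
  ultimately have "P K x = 0" if "K \<in> Kclasses m lam" for K x
    using exp_fun_independent[OF finite_Kclasses inj_on_lam_Min _ _ that] by blast
  then have zero: "(\<Sum>k\<in>K. ?f a k x) = 0" if "K \<in> Kclasses m lam" for K x
    unfolding P[OF that] using that by simp
  \<comment> \<open>The components of \<open>a\<close> are its restrictions to the classes.\<close>
  define x where "x = (\<lambda>K k. if k \<in> K then a k else (\<lambda>_. 0))"
  have "x K \<in> phi K ` Hset p lam K" if K: "K \<in> Kclasses m lam" for K
    unfolding phi_Hset[OF K] using zero[OF K] w K by (auto simp: x_def Kclasses_def)
  moreover have "a = (\<lambda>k c. \<Sum>K\<in>Kclasses m lam. x K k c)"
  proof (intro ext)
    fix k c
    show "a k c = (\<Sum>K\<in>Kclasses m lam. x K k c)"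
    proof (cases "k < m")
      case True
      then obtain K where "K \<in> Kclasses m lam" "k \<in> K" using Kclasses_mem_iff[of _ m lam k] by blast
      then show ?thesis by (subst sum_Kclasses_supported) (auto simp: x_def)
    next
      case False
      with a have "a k = (\<lambda>_. 0)" by (simp add: kerset_def row_space_def)
      then have "x K k = (\<lambda>_. 0)" for K by (simp add: x_def)
      then show ?thesis using \<open>a k = (\<lambda>_. 0)\<close> by simp
    qed
  qed
  ultimately show "a \<in> ?R" unfolding vsum_sets_def by blast
next
  fix a assume "a \<in> ?R"
  then obtain x where a: "a = (\<lambda>k c. \<Sum>K\<in>Kclasses m lam. x K k c)"
    and "\<forall>K\<in>Kclasses m lam. x K \<in> phi K ` Hset p lam K"
    unfolding vsum_sets_def by blast
  then have x: "\<And>K k. K \<in> Kclasses m lam \<Longrightarrow> k \<notin> K \<Longrightarrow> x K k = (\<lambda>_. 0)"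
    "\<And>K k. K \<in> Kclasses m lam \<Longrightarrow> k \<in> K \<Longrightarrow> is_weyl (x K k)"
    "\<And>K z. K \<in> Kclasses m lam \<Longrightarrow>
      (\<Sum>k\<in>K. act (x K k) (\<lambda>z. poly_fun (p k) z * exp_fun (lam k) z) z) = 0"
    by (simp_all add: phi_Hset)
  have a_eq: "a k = x K k" if "K \<in> Kclasses m lam" "k \<in> K" for K k
    unfolding a by (rule ext, rule sum_Kclasses_supported[OF x(1) that])
  have "a \<in> row_space m"
    unfolding row_space_def
  proof (intro CollectI conjI allI impI)
    fix k assume "k < m"
    then obtain K where "K \<in> Kclasses m lam" "k \<in> K" using Kclasses_mem_iff[of _ m lam k] by blast
    then show "is_weyl (a k)" by (simp add: a_eq x)
  next
    fix k assume "m \<le> k"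
    then have "x K k = (\<lambda>_. 0)" if "K \<in> Kclasses m lam" for K
      using x(1)[OF that] Kclasses_mem_iff[of K m lam k] that by auto
    then show "a k = (\<lambda>_. 0)" by (simp add: a)
  qed
  moreover have "(\<Sum>k<m. act (a k) (epvec m p lam k) z) = 0" for z
  proof -
    have "(\<Sum>k<m. act (a k) (epvec m p lam k) z)
        = (\<Sum>k<m. act (a k) (\<lambda>z. poly_fun (p k) z * exp_fun (lam k) z) z)"
      by (simp add: epvec_def)
    also have "\<dots> = (\<Sum>K\<in>Kclasses m lam. \<Sum>k\<in>K. act (x K k) (\<lambda>z. poly_fun (p k) z * exp_fun (lam k) z) z)"
      unfolding sum_Kclasses[of _ m lam] by (intro sum.cong refl) (simp add: a_eq)
    also have "\<dots> = 0" by (simp add: x(3))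
    finally show ?thesis .
  qed
  ultimately show "a \<in> ?L" by (simp add: kerset_def)
qed

text \<open>Directness is a matter of supports: rows of distinct summands live on disjoint sets of
  positions.\<close>

lemma is_direct_phi_Hset:
  "is_direct (Kclasses m lam) (\<lambda>K. phi K ` Hset p lam K)"
  unfolding is_direct_def
proof (intro allI impI ballI ext)
  fix x K k c
  assume x: "(\<forall>K\<in>Kclasses m lam. x K \<in> phi K ` Hset p lam K)
      \<and> (\<lambda>k c. \<Sum>K\<in>Kclasses m lam. x K k c) = (\<lambda>k c. 0)"
    and K: "K \<in> Kclasses m lam"
  have supp: "\<And>K k. K \<in> Kclasses m lam \<Longrightarrow> k \<notin> K \<Longrightarrow> x K k = (\<lambda>_. 0)"
    using x by (simp add: phi_Hset)
  show "x K k c = 0"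
  proof (cases "k \<in> K")
    case True
    have "x K k c = (\<Sum>K\<in>Kclasses m lam. x K k c)"
      by (rule sum_Kclasses_supported[OF supp K True, symmetric])
    also have "\<dots> = 0" using fun_cong[OF fun_cong[OF conjunct2[OF x]]] .
    finally show ?thesis .
  qed (simp add: supp K)
qed

section \<open>Generated modules and their solution sets\<close>

lemma row_space_is_weyl: "a \<in> row_space m \<Longrightarrow> is_weyl (a j)"
  by (cases "j < m") (simp_all add: row_space_def is_weyl_def)

lemma row_mem_gen_module:
  fixes R :: "nat \<Rightarrow> nat \<Rightarrow> 'n::finite weyl"
  assumes "R r \<in> row_space m" "r < k"
  shows "R r \<in> gen_module k R"
proof -
  define co where "co = (\<lambda>r'. if r' = r then weyl_one else (\<lambda>_. 0 :: complex) :: 'n weyl)"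
  have "(\<Sum>r'<k. weyl_mult (co r') (R r' j) c) = (\<Sum>r'<k. if r' = r then R r j c else 0)" for j c
    by (intro sum.cong refl)
      (auto simp: co_def weyl_mult_zero_left weyl_mult_one row_space_is_weyl[OF assms(1)])
  then have "R r = (\<lambda>j c. \<Sum>r'<k. weyl_mult (co r') (R r' j) c)"
    using assms(2) by (simp add: fun_eq_iff)
  moreover have "is_weyl (co r')" for r'
    by (auto simp: co_def is_weyl_one) (simp add: is_weyl_def)
  ultimately show ?thesis unfolding gen_module_def by blast
qed

lemma act_zero_right: "act w (\<lambda>x. 0) x = 0"
  \<comment> \<open>The zero signal is the empty sum.\<close>
  using act_sum_right[of "{}" "\<lambda>_ _. 0" w x] by simp

text \<open>By \<open>act_weyl_mult\<close> each coefficient \<open>co r\<close> acts after its row,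
  hence on the zero signal.\<close>

lemma gen_module_annihilates:
  assumes R: "\<And>r. r < k \<Longrightarrow> R r \<in> row_space m" and g: "g \<in> solset m k R"
    and a: "a \<in> gen_module k R"
  shows "(\<Sum>j<m. act (a j) (g j) x) = 0"
proof -
  from a obtain co where co: "\<And>r. r < k \<Longrightarrow> is_weyl (co r)"
    and a_eq: "a = (\<lambda>j c. \<Sum>r<k. weyl_mult (co r) (R r j) c)"
    unfolding gen_module_def by blast
  have g': "\<And>j. j < m \<Longrightarrow> smooth (g j)"
    "\<And>r. r < k \<Longrightarrow> (\<lambda>x. \<Sum>j<m. act (R r j) (g j) x) = (\<lambda>x. 0)"
    using g by (auto simp: solset_def sigvec_def)
  have "(\<Sum>j<m. act (a j) (g j) x) = (\<Sum>j<m. \<Sum>r<k. act (co r) (act (R r j) (g j)) x)"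
  proof (rule sum.cong[OF refl])
    fix j assume "j \<in> {..<m}"
    then have "smooth (g j)" using g' by simp
    then show "act (a j) (g j) x = (\<Sum>r<k. act (co r) (act (R r j) (g j)) x)"
      unfolding a_eq
      by (subst act_sum)
        (simp_all add: is_weyl_weyl_mult act_weyl_mult co row_space_is_weyl[OF R])
  qed
  also have "\<dots> = (\<Sum>r<k. \<Sum>j<m. act (co r) (act (R r j) (g j)) x)"
    by (rule sum.swap)
  also have "\<dots> = (\<Sum>r<k. act (co r) (\<lambda>x. \<Sum>j<m. act (R r j) (g j) x) x)"
    by (intro sum.cong refl act_sum_right[symmetric]) (simp add: smooth_act g')
  also have "\<dots> = 0" by (simp add: g'(2) act_zero_right)
  finally show ?thesis .
qed

lemma epvec_sigvec: "epvec m p lam \<in> sigvec m"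
  by (simp add: sigvec_def epvec_def smooth_mult smooth_exp_fun poly_funs_smooth poly_fun_poly_funs)

text \<open>A solution set contains \<open>q\<close> exactly when its rows lie in
  \<open>kerset m q\<close>. Generators of this kernel therefore imply every equation that
  \<open>q\<close> satisfies, whatever the form of \<open>q\<close>.\<close>

lemma is_VMPUM_solset:
  assumes R: "\<And>r. r < k \<Longrightarrow> R r \<in> row_space m" and q: "q \<in> sigvec m"
    and gen: "gen_module k R = kerset m q"
  shows "is_VMPUM m {q} (solset m k R)"
  unfolding is_VMPUM_def
proof (intro conjI allI impI)
  show "is_solset m (solset m k R)" unfolding is_solset_def using R by blast
  have "R r \<in> kerset m q" if "r < k" for r
    using row_mem_gen_module[where R = R, OF R[OF that] that] gen by simp
  then show "{q} \<subseteq> solset m k R" using q by (simp add: solset_def kerset_def)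
  fix S' assume S': "is_solset m S' \<and> {q} \<subseteq> S'"
  then obtain k' R' where R': "\<forall>r<k'. R' r \<in> row_space m" and S'_eq: "S' = solset m k' R'"
    unfolding is_solset_def by blast
  have "R' r \<in> gen_module k R" if "r < k'" for r
    using S' that R' by (simp add: gen kerset_def S'_eq solset_def)
  then have "(\<Sum>j<m. act (R' r j) (g j) x) = 0" if "g \<in> solset m k R" "r < k'" for g r x
    using gen_module_annihilates[OF R that(1)] that(2) by blast
  then show "solset m k R \<subseteq> S'" by (auto simp: S'_eq solset_def)
qed

theorem theorem5p7:
  fixes m :: nat and p :: "nat \<Rightarrow> ('n::finite) cpoly" and lam :: "nat \<Rightarrow> 'n \<Rightarrow> complex"
  assumes "\<forall>j<m. is_cpoly (p j)"
  shows "kerset m (epvec m p lam) = vsum_sets (Kclasses m lam) (\<lambda>K. phi K ` Hset p lam K)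
     \<and> is_direct (Kclasses m lam) (\<lambda>K. phi K ` Hset p lam K)
     \<and> (\<forall>k R. (\<forall>r<k. R r \<in> row_space m)
            \<and> gen_module k R = vsum_sets (Kclasses m lam) (\<lambda>K. phi K ` Hset p lam K)
          \<longrightarrow> is_VMPUM m {epvec m p lam} (solset m k R))"
  using is_VMPUM_solset[OF _ epvec_sigvec[of m p lam]]
  by (simp add: kerset_epvec is_direct_phi_Hset)

end
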